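(* Assign to the nearest-neighbour edges of $\mathbf{Z}^2$ independent, identically distributed exponential passage times of mean $1$. Let $\mathbf{v}$ be any unit vector in $\mathbb{R}^2$, for each integer $n \ge 1$ let $\mathbf{v}^{(n)} \in \mathbf{Z}^2$ be the vector whose coordinates are the integer parts of the coordinates of $n\mathbf{v}$, and let $T(0,\mathbf{v}^{(n)})$ be the first-passage time from the origin to the vertex $\mathbf{v}^{(n)}$. Then there is a constant $C > 0$ such that $$\mathrm{Var}\big(T(0,\mathbf{v}^{(n)})\big) \ge C \log n \quad \text{for all } n \ge 1.$$ Moreover, for any sequence of (deterministic) intervals $[a_n, b_n]$ with $b_n - a_n = o\big((\log n)^{1/2}\big)$ as $n \to \infty$, $$\mathbf{P}\big(T(0,\mathbf{v}^{(n)}) \in [a_n, b_n]\big) \to 0 \quad \text{as } n \to \infty.$$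
   Context: First-passage percolation on $\mathbf{Z}^2$: the graph has vertex set $\mathbf{Z}^2$ and edges joining vertices at Euclidean distance $1$. Each edge $e$ carries a nonnegative random passage time $t(e)$. The passage time of a finite lattice path is the sum of $t(e)$ over its edges, and for vertices $x,y$ the first-passage time $T(x,y)$ is the infimum of the passage times over all finite lattice paths from $x$ to $y$ (with $T(x,x)=0$). The integer part of a real number $r$ is $\lfloor r \rfloor$. *)

theory Defs
  imports "HOL-Probability.Probability" "HOL-Library.Landau_Symbols"
begin

type_synonym vertex = "int \<times> int"

definition real_point :: "vertex \<Rightarrow> real \<times> real" where
  "real_point x = (real_of_int (fst x), real_of_int (snd x))"

text \<open>The library distance on \<^typ>\<open>real \<times> real\<close> is the Euclidean one.
  Edges are undirected, hence two-element sets of vertices.\<close>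

definition adjacent :: "vertex \<Rightarrow> vertex \<Rightarrow> bool" where
  "adjacent x y \<longleftrightarrow> dist (real_point x) (real_point y) = 1"

definition lattice_edges :: "vertex set set" where
  "lattice_edges = {{x, y} | x y. adjacent x y}"

text \<open>A path is the list of its successive vertices; the one-vertex path has no edges.
  Paths may revisit vertices, and an edge counts as often as it is traversed, which does
  not affect the infimum for nonnegative passage times.\<close>

definition lattice_path :: "vertex \<Rightarrow> vertex \<Rightarrow> vertex list \<Rightarrow> bool" where
  "lattice_path x y p \<longleftrightarrow> p \<noteq> [] \<and> hd p = x \<and> last p = y \<and> successively adjacent p"

definition path_time :: "(vertex set \<Rightarrow> real) \<Rightarrow> vertex list \<Rightarrow> real" where
  "path_time t p = (\<Sum>i < length p - 1. t {p ! i, p ! Suc i})"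

definition first_passage_time :: "(vertex set \<Rightarrow> real) \<Rightarrow> vertex \<Rightarrow> vertex \<Rightarrow> real" where
  "first_passage_time t x y = (INF p \<in> {p. lattice_path x y p}. path_time t p)"

definition lattice_point :: "real \<times> real \<Rightarrow> nat \<Rightarrow> vertex" where
  "lattice_point v n = (\<lfloor>real n * fst v\<rfloor>, \<lfloor>real n * snd v\<rfloor>)"

end

theory Submission
  imports Defs
begin

text \<open>The proof perturbs the passage times and compares laws.  Let \<open>y\<close> be the endpoint,
\<open>N\<close> its \<open>\<ell>\<^sup>1\<close> norm, and give an edge at \<open>\<ell>\<^sup>1\<close> distance \<open>r \<le> N\<close> from the
origin the small number \<open>\<beta> \<approx> \<alpha> / (r \<surd>ln N)\<close>.  For \<open>j < K\<close> let \<open>T j\<close> be the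
first-passage time from the origin to \<open>y\<close> when every passage time \<open>t e\<close> is replaced by
\<open>t e / (1 - j \<beta> e)\<close>.  Two facts compete.

\<^item> The perturbation is nearly invisible in law.  A rescaled exponential variable is
absolutely continuous with respect to the original one, and the density of one whole
configuration with respect to the other has second moment at most
\<open>exp (2 \<Sum> (j \<beta> e)\<^sup>2)\<close>.  There are \<open>O(r)\<close> edges at distance \<open>r\<close>, so the sum is of order
\<open>\<alpha>\<^sup>2 (\<Sum>r\<le>N. r / r\<^sup>2) / ln N\<close>, hence \<open>O(\<alpha>\<^sup>2)\<close> uniformly in \<open>N\<close>: this is where the dimension two enters.
Thus \<open>P(T 0 \<in> I)\<close> and \<open>P(T j \<in> I)\<close> differ by at most a small \<open>\<eta>\<close>
(\<open>prob_le_prob_scaled\<close>).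

\<^item> The perturbation moves the first-passage time by order \<open>\<surd>ln N\<close>.  The increments of the
\<open>T j\<close> are at least the infimum of the \<open>\<beta>\<close>-weighted passage times of the paths to \<open>y\<close>.
Counting self-avoiding walks shows that, off an event of small probability, every self-avoiding walk of
length \<open>r \<ge> r0\<close> from the origin costs at least a constant times \<open>r\<close>
(\<open>prob_fast_walk_from_le\<close>); summation by parts turns this linear growth into a weighted passage
time of at least a constant times \<open>(ln N - ln (r0 + 1)) / \<surd>ln N\<close>
(\<open>weighted_path_time_ge\<close>).

So when an interval \<open>I\<close> is shorter than a small multiple of \<open>\<surd>ln N\<close>, the events
\<open>T j \<in> I\<close> for \<open>j < K\<close> are disjoint off a small event, although they have nearly the same
probability; that probability is therefore at most \<open>1 / K\<close> plus small terms
(\<open>small_intervals_unlikely\<close>).  This is the second claim.  Applied to the interval of half-length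
\<open>c \<surd>ln N\<close> around the mean it also gives the variance bound for large \<open>n\<close>, by Chebyshev's
inequality.  For the finitely many remaining \<open>n \<ge> 2\<close> it suffices that the variance is positive,
and for \<open>n = 1\<close> the bound is \<open>0\<close>.\<close>

section \<open>Levels of vertices and edges\<close>

lemma adjacent_iff: "adjacent x y \<longleftrightarrow> (fst x - fst y)\<^sup>2 + (snd x - snd y)\<^sup>2 = 1"
proof -
  have "adjacent x y \<longleftrightarrow>
      real_of_int ((fst x - fst y)\<^sup>2 + (snd x - snd y)\<^sup>2) = real_of_int 1"
    by (simp add: adjacent_def real_point_def dist_Pair_Pair dist_real_def)
  then show ?thesis
    by (simp only: of_int_eq_iff)
qed

lemma adjacent_sym: "adjacent x y \<Longrightarrow> adjacent y x"
  by (simp add: adjacent_def dist_commute)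

definition neighbours :: "vertex \<Rightarrow> vertex set" where
  "neighbours x =
    {(fst x + 1, snd x), (fst x - 1, snd x), (fst x, snd x + 1), (fst x, snd x - 1)}"

lemma adjacent_iff_neighbours: "adjacent x y \<longleftrightarrow> y \<in> neighbours x"
proof
  assume "adjacent x y"
  then have 1: "(fst x - fst y)\<^sup>2 + (snd x - snd y)\<^sup>2 = 1"
    by (simp add: adjacent_iff)
  then have "(fst x - fst y)\<^sup>2 \<le> 1" "(snd x - snd y)\<^sup>2 \<le> 1"
    by (smt (verit) zero_le_power2)+
  then have "\<bar>fst x - fst y\<bar> \<le> 1" "\<bar>snd x - snd y\<bar> \<le> 1"
    by (simp_all add: abs_square_le_1)
  then have "fst x - fst y \<in> {-1, 0, 1}" "snd x - snd y \<in> {-1, 0, 1}"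
    by auto
  with 1 have "(fst x - fst y, snd x - snd y) \<in> {(1, 0), (-1, 0), (0, 1), (0, -1)}"
    by auto
  then show "y \<in> neighbours x"
    by (cases y) (auto simp: neighbours_def)
qed (auto simp: adjacent_iff neighbours_def)

lemma finite_neighbours: "finite (neighbours x)"
  by (simp add: neighbours_def)

lemma card_neighbours_le: "card (neighbours x) \<le> 4"
  unfolding neighbours_def by (rule order_trans[OF card_insert_le_m1]) (auto simp: card_insert_if)

text \<open>The \<open>\<ell>\<^sup>1\<close> norm is the convenient radius, as every step of a path changes it by exactly
one.\<close>

definition level :: "vertex \<Rightarrow> nat" where
  "level x = nat (\<bar>fst x\<bar> + \<bar>snd x\<bar>)"

definition edge_level :: "vertex set \<Rightarrow> nat" where
  "edge_level e = Max (level ` e)"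

lemma level_origin [simp]: "level (0, 0) = 0"
  by (simp add: level_def)

lemma level_adjacent: "adjacent x y \<Longrightarrow> level y = Suc (level x) \<or> level x = Suc (level y)"
  unfolding adjacent_iff_neighbours neighbours_def level_def
  by (cases x; cases y) (simp, arith)

lemma edge_level_pair [simp]: "edge_level {x, y} = max (level x) (level y)"
  by (simp add: edge_level_def)

lemma edge_level_pos: "e \<in> lattice_edges \<Longrightarrow> 1 \<le> edge_level e"
  using level_adjacent by (fastforce simp: lattice_edges_def)

section \<open>Paths and loop erasure\<close>

lemma path_time_single [simp]: "path_time t [x] = 0"
  by (simp add: path_time_def)

lemma path_time_Cons_Cons [simp]: "path_time t (x # y # p) = t {x, y} + path_time t (y # p)"
  by (simp add: path_time_def sum.lessThan_Suc_shift del: sum.lessThan_Suc)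

lemma path_time_Cons: "p \<noteq> [] \<Longrightarrow> path_time t (x # p) = t {x, hd p} + path_time t p"
  by (cases p) auto

lemma edge_in_lattice: "adjacent x y \<Longrightarrow> {x, y} \<in> lattice_edges"
  unfolding lattice_edges_def by blast

lemma path_edge_in_lattice:
  "successively adjacent p \<Longrightarrow> Suc i < length p \<Longrightarrow> {p ! i, p ! Suc i} \<in> lattice_edges"
  using edge_in_lattice successively_nth by metis

lemma path_time_mono:
  assumes "successively adjacent p" "\<And>e. e \<in> lattice_edges \<Longrightarrow> s e \<le> t e"
  shows "path_time s p \<le> path_time t p"
  unfolding path_time_def
  by (intro sum_mono assms path_edge_in_lattice) auto

lemma path_time_nonneg:
  assumes "successively adjacent p" "\<And>e. e \<in> lattice_edges \<Longrightarrow> 0 \<le> t e"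
  shows "0 \<le> path_time t p"
  unfolding path_time_def
  by (intro sum_nonneg assms path_edge_in_lattice) auto

lemma path_time_append_ge:
  assumes "successively adjacent (p @ q)" "\<And>e. e \<in> lattice_edges \<Longrightarrow> 0 \<le> t e"
  shows "path_time t p \<le> path_time t (p @ q)" and "path_time t q \<le> path_time t (p @ q)"
proof -
  show "path_time t p \<le> path_time t (p @ q)"
    unfolding path_time_def
  proof (rule sum_le_included[where i = "\<lambda>i. i"])
    show "\<forall>i\<in>{..<length (p @ q) - 1}. 0 \<le> t {(p @ q) ! i, (p @ q) ! Suc i}"
      using assms path_edge_in_lattice[OF assms(1)] by auto
  qed (auto simp: nth_append)
  show "path_time t q \<le> path_time t (p @ q)"
    using assms
  proof (induction p)
    case (Cons x p)
    show ?case
    proof (cases "p @ q = []")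
      case False
      then have "path_time t q \<le> path_time t (p @ q)" "{x, hd (p @ q)} \<in> lattice_edges"
        using Cons by (auto simp: successively_Cons intro: edge_in_lattice)
      then show ?thesis
        using False Cons.prems(2)[of "{x, hd (p @ q)}"] path_time_Cons[of "p @ q" t x] by simp
    qed (auto simp: path_time_def)
  qed simp
qed

text \<open>Cutting out loops only removes nonnegative terms.  Self-avoiding paths matter because the
passage times of their distinct edges are independent.\<close>

lemma loop_erasure:
  assumes "lattice_path x y p" "\<And>e. e \<in> lattice_edges \<Longrightarrow> 0 \<le> t e"
  shows "\<exists>q. lattice_path x y q \<and> distinct q \<and> set q \<subseteq> set p \<and> path_time t q \<le> path_time t p"
  using assms(1)
proof (induction p arbitrary: x)
  case Nil
  then show ?case
    by (simp add: lattice_path_def)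
next
  case (Cons a p)
  then have a: "a = x"
    by (simp add: lattice_path_def)
  show ?case
  proof (cases "p = []")
    case True
    then show ?thesis
      using Cons.prems by (intro exI[of _ "[a]"]) (auto simp: lattice_path_def)
  next
    case False
    then have p: "lattice_path (hd p) y p" "adjacent x (hd p)"
      using Cons.prems a by (auto simp: lattice_path_def successively_Cons)
    then obtain q where q: "lattice_path (hd p) y q" "distinct q" "set q \<subseteq> set p"
      "path_time t q \<le> path_time t p"
      using Cons.IH by blast
    have le: "path_time t q \<le> path_time t (a # p)"
      using q(4) path_time_Cons[OF False, of t a] assms(2)[OF edge_in_lattice[OF p(2)]] a by simp
    show ?thesis
    proof (cases "x \<in> set q")
      case True
      then obtain q1 q2 where q12: "q = q1 @ x # q2"
        by (meson split_list)
      have "path_time t (x # q2) \<le> path_time t q"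
        unfolding q12 by (rule path_time_append_ge) (use q(1) q12 assms(2) in \<open>auto simp: lattice_path_def\<close>)
      then show ?thesis
        using q q12 le by (intro exI[of _ "x # q2"])
          (auto simp: lattice_path_def successively_append_iff)
    next
      case False
      have "q \<noteq> []" "hd q = hd p"
        using q by (auto simp: lattice_path_def)
      then have "path_time t (x # q) \<le> path_time t (a # p)"
        using q(4) a path_time_Cons[OF \<open>p \<noteq> []\<close>, of t a] path_time_Cons[of q t x] by simp
      then show ?thesis
        using q p(2) False a by (intro exI[of _ "x # q"])
          (auto simp: lattice_path_def successively_Cons)
    qed
  qed
qed

text \<open>Stopping a path at its first visit to the sphere of radius \<open>r\<close>.\<close>

lemma path_until_level:
  assumes "successively adjacent p" "p \<noteq> []" "level (hd p) \<le> r" "r \<le> level (last p)"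
    and nonneg: "\<And>e. e \<in> lattice_edges \<Longrightarrow> 0 \<le> t e"
  shows "\<exists>q. q \<noteq> [] \<and> successively adjacent q \<and> hd q = hd p \<and> level (last q) = r \<and>
    (\<forall>z\<in>set q. level z \<le> r) \<and> path_time t q \<le> path_time t p"
  using assms(1-4)
proof (induction p)
  case (Cons x p)
  show ?case
  proof (cases "level x = r")
    case True
    then show ?thesis
      using path_time_nonneg[OF Cons.prems(1) nonneg] by (intro exI[of _ "[x]"]) auto
  next
    case False
    then have x: "level x < r" "p \<noteq> []"
      using Cons.prems by (auto split: if_splits)
    then have adj: "adjacent x (hd p)" "successively adjacent p"
      using Cons.prems by (auto simp: successively_Cons)
    then have "level (hd p) \<le> r" "r \<le> level (last p)"
      using x level_adjacent[of x "hd p"] Cons.prems by auto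
    then obtain q where q: "q \<noteq> []" "successively adjacent q" "hd q = hd p" "level (last q) = r"
      "\<forall>z\<in>set q. level z \<le> r" "path_time t q \<le> path_time t p"
      using Cons.IH adj x by blast
    then show ?thesis
      using x adj by (intro exI[of _ "x # q"]) (auto simp: successively_Cons path_time_Cons)
  qed
qed simp

lemma level_last_le:
  "successively adjacent p \<Longrightarrow> p \<noteq> [] \<Longrightarrow> level (last p) < level (hd p) + length p"
proof (induction p)
  case (Cons x p)
  show ?case
  proof (cases "p = []")
    case False
    then show ?thesis
      using Cons level_adjacent[of x "hd p"] by (auto simp: successively_Cons)
  qed simp
qed simp

definition walks :: "vertex \<Rightarrow> nat \<Rightarrow> vertex list set" where
  "walks x r = {p. length p = Suc r \<and> hd p = x \<and> successively adjacent p}"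

lemma walks_0: "walks x 0 = {[x]}"
  by (auto simp: walks_def length_Suc_conv)

lemma walks_Suc: "walks x (Suc r) = (\<Union>z\<in>neighbours x. (#) x ` walks z r)"
proof
  show "walks x (Suc r) \<subseteq> (\<Union>z\<in>neighbours x. (#) x ` walks z r)"
  proof
    fix p assume "p \<in> walks x (Suc r)"
    then obtain z q where "p = x # z # q" "adjacent x z" "z # q \<in> walks z r"
      by (auto simp: walks_def length_Suc_conv)
    then show "p \<in> (\<Union>z\<in>neighbours x. (#) x ` walks z r)"
      by (auto simp: adjacent_iff_neighbours)
  qed
qed (auto simp: walks_def successively_Cons adjacent_iff_neighbours)

lemma finite_walks: "finite (walks x r)"
  by (induction r arbitrary: x) (auto simp: walks_0 walks_Suc finite_neighbours)

lemma card_walks_le: "card (walks x r) \<le> 4 ^ r"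
proof (induction r arbitrary: x)
  case (Suc r)
  have "card (walks x (Suc r)) \<le> (\<Sum>z\<in>neighbours x. card ((#) x ` walks z r))"
    unfolding walks_Suc by (rule card_UN_le[OF finite_neighbours])
  also have "\<dots> \<le> (\<Sum>z\<in>neighbours x. 4 ^ r)"
    by (intro sum_mono order_trans[OF card_image_le[OF finite_walks] Suc])
  also have "\<dots> \<le> 4 ^ Suc r"
    using card_neighbours_le[of x] by simp
  finally show ?case .
qed (simp add: walks_0)

text \<open>A self-avoiding walk crosses each of its edges once, so its passage time is a sum of independent
variables.\<close>

lemma path_time_eq_sum_edges:
  assumes "q \<in> walks x r" "distinct q"
  obtains F where "finite F" "F \<subseteq> lattice_edges" "card F = r" "\<And>t. path_time t q = sum t F"
proof
  let ?f = "\<lambda>i. {q ! i, q ! Suc i}"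
  have len: "length q = Suc r" and succ: "successively adjacent q"
    using assms by (auto simp: walks_def)
  have inj: "inj_on ?f {..<r}"
    using assms(2) len by (auto simp: inj_on_def doubleton_eq_iff nth_eq_iff_index_eq)
  show "finite (?f ` {..<r})" "card (?f ` {..<r}) = r"
    using card_image[OF inj] by auto
  show "?f ` {..<r} \<subseteq> lattice_edges"
    using path_edge_in_lattice[OF succ] len by auto
  show "path_time t q = sum t (?f ` {..<r})" for t
    using sum.reindex[OF inj, of t] len by (simp add: path_time_def)
qed

text \<open>A path to a vertex of level at least \<open>r\<close> is stopped at level \<open>r\<close>, freed of loops, and
cut to its first \<open>r\<close> edges; these exist because the level grows by at most one per step.  A fixed
length keeps the later union bound down to \<open>4 ^ r\<close> walks.\<close>

lemma self_avoiding_crossing: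
  assumes p: "lattice_path (0, 0) y p" and r: "r \<le> level y"
    and nonneg: "\<And>e. e \<in> lattice_edges \<Longrightarrow> 0 \<le> t e"
  shows "\<exists>q\<in>walks (0, 0) r. distinct q \<and> (\<forall>z\<in>set q. level z \<le> r) \<and> path_time t q \<le> path_time t p"
proof -
  obtain q1 where q1: "q1 \<noteq> []" "successively adjacent q1" "hd q1 = (0, 0)" "level (last q1) = r"
    "\<forall>z\<in>set q1. level z \<le> r" "path_time t q1 \<le> path_time t p"
    using path_until_level[of p r t] p r nonneg by (auto simp: lattice_path_def)
  then have "lattice_path (0, 0) (last q1) q1"
    by (simp add: lattice_path_def)
  from loop_erasure[of _ _ _ t, OF this nonneg] obtain q2
    where q2: "lattice_path (0, 0) (last q1) q2" "distinct q2" "set q2 \<subseteq> set q1"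
      "path_time t q2 \<le> path_time t q1"
    by blast
  have succ: "successively adjacent q2" and ne: "q2 \<noteq> []"
    using q2 by (auto simp: lattice_path_def)
  have len: "r < length q2"
    using level_last_le[OF succ ne] q2(1) q1(4) by (simp add: lattice_path_def)
  let ?q = "take (Suc r) q2"
  have "successively adjacent ?q"
    using succ append_take_drop_id[of "Suc r" q2] successively_append_iff by metis
  then have "?q \<in> walks (0, 0) r"
    using len q2(1) by (auto simp: walks_def lattice_path_def)
  moreover have "path_time t ?q \<le> path_time t q2"
    using path_time_append_ge(1)[of ?q "drop (Suc r) q2" t] succ nonneg by simp
  moreover have "\<forall>z\<in>set ?q. level z \<le> r"
    using q1 q2 set_take_subset[of "Suc r" q2] by blast
  ultimately show ?thesis
    using q1 q2 by (intro bexI[of _ ?q]) (auto intro: distinct_take)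
qed

lemma ex_lattice_path: "\<exists>p. lattice_path (0, 0) y p"
proof (induction "level y" arbitrary: y)
  case 0
  then have "y = (0, 0)"
    by (auto simp: level_def prod_eq_iff)
  then show ?case
    by (intro exI[of _ "[(0, 0)]"]) (simp add: lattice_path_def)
next
  case (Suc n)
  obtain a b where y: "y = (a, b)"
    by (cases y)
  \<comment> \<open>A neighbour one step closer to the origin.\<close>
  define z where "z = (if a > 0 then (a - 1, b) else if a < 0 then (a + 1, b)
    else if b > 0 then (a, b - 1) else (a, b + 1))"
  have "n = level z" "adjacent z y"
    using Suc.hyps(2) by (auto simp: z_def y level_def adjacent_iff_neighbours neighbours_def)
  then obtain p where "lattice_path (0, 0) z p"
    using Suc.hyps(1) by blast
  then show ?case
    using \<open>adjacent z y\<close> by (intro exI[of _ "p @ [y]"])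
      (auto simp: lattice_path_def successively_append_iff)
qed

section \<open>First-passage times as functions of the edge weights\<close>

lemma path_time_le_first_passage:
  assumes "\<And>e. e \<in> lattice_edges \<Longrightarrow> 0 \<le> s e" "lattice_path x y p"
  shows "first_passage_time s x y \<le> path_time s p"
  unfolding first_passage_time_def
proof (rule cINF_lower)
  show "bdd_below (path_time s ` {p. lattice_path x y p})"
    using assms(1) path_time_nonneg by (intro bdd_belowI[of _ 0]) (auto simp: lattice_path_def)
qed (use assms in simp)

text \<open>The infimum is over a nonempty set because \<open>\<int>\<^sup>2\<close> is connected.\<close>

lemma first_passage_time_ge:
  assumes "\<And>p. lattice_path (0, 0) y p \<Longrightarrow> c \<le> path_time s p"
  shows "c \<le> first_passage_time s (0, 0) y"
  unfolding first_passage_time_def using ex_lattice_path[of y] assms by (intro cINF_greatest) auto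

text \<open>First-passage times are superadditive in the weights.  Here the bound on \<open>d\<close> is required of
every path to \<open>y\<close>, so no minimising path has to be chosen or even shown to exist.\<close>

lemma first_passage_time_add_le:
  assumes s: "\<And>e. e \<in> lattice_edges \<Longrightarrow> 0 \<le> s e"
    and s': "\<And>e. e \<in> lattice_edges \<Longrightarrow> s e + d e \<le> s' e"
    and d: "\<And>p. lattice_path (0, 0) y p \<Longrightarrow> c \<le> path_time d p"
  shows "first_passage_time s (0, 0) y + c \<le> first_passage_time s' (0, 0) y"
proof (rule first_passage_time_ge)
  fix p assume p: "lattice_path (0, 0) y p"
  have "first_passage_time s (0, 0) y + c \<le> path_time s p + path_time d p"
    using path_time_le_first_passage[of s, OF s p] d[OF p] by simp
  also have "\<dots> = path_time (\<lambda>e. s e + d e) p"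
    by (simp add: path_time_def sum.distrib)
  also have "\<dots> \<le> path_time s' p"
    using p s' by (intro path_time_mono) (auto simp: lattice_path_def)
  finally show "first_passage_time s (0, 0) y + c \<le> path_time s' p" .
qed

lemma path_time_cong:
  "successively adjacent p \<Longrightarrow> (\<And>e. e \<in> lattice_edges \<Longrightarrow> s e = t e) \<Longrightarrow> path_time s p = path_time t p"
  by (intro antisym path_time_mono) auto

lemma first_passage_time_restrict:
  "first_passage_time (\<lambda>e\<in>lattice_edges. s e) x y = first_passage_time s x y"
  unfolding first_passage_time_def
  by (intro INF_cong refl path_time_cong) (auto simp: lattice_path_def)

lemma path_time_measurable:
  assumes "successively adjacent p"
  shows "(\<lambda>s. path_time s p) \<in> borel_measurable (Pi\<^sub>M lattice_edges (\<lambda>_. borel))"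
  unfolding path_time_def using path_edge_in_lattice[OF assms]
  by (intro borel_measurable_sum measurable_component_singleton) auto

text \<open>There are only countably many finite lattice paths.\<close>

lemma first_passage_time_measurable:
  "(\<lambda>s. first_passage_time s x y) \<in> borel_measurable (Pi\<^sub>M lattice_edges (\<lambda>_. borel))"
  unfolding first_passage_time_def
  by (intro borel_measurable_cINF_real path_time_measurable) (auto simp: lattice_path_def)

section \<open>Logarithmic edge weights\<close>

text \<open>A vertex of given level is determined by its first coordinate and the sign of the second.\<close>

lemma sphere_subset:
  "{x. level x = r} \<subseteq> (\<lambda>(a, s). (a, s * (int r - \<bar>a\<bar>))) ` ({- int r..int r} \<times> {1, -1})"
proof
  fix x assume "x \<in> {x. level x = r}"
  then have r: "int r = \<bar>fst x\<bar> + \<bar>snd x\<bar>"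
    by (auto simp: level_def)
  show "x \<in> (\<lambda>(a, s). (a, s * (int r - \<bar>a\<bar>))) ` ({- int r..int r} \<times> {1, -1})"
    by (rule image_eqI[of _ _ "(fst x, if snd x \<ge> 0 then 1 else -1)"])
      (use r in \<open>auto simp: prod_eq_iff\<close>)
qed

lemma finite_sphere: "finite {x. level x = r}"
  by (rule finite_subset[OF sphere_subset]) auto

lemma card_sphere_le:
  assumes "1 \<le> r"
  shows "card {x. level x = r} \<le> 6 * r"
proof -
  let ?D = "{- int r..int r} \<times> {1, -1 :: int}"
  have "card {x. level x = r} \<le> card ?D"
    by (rule surj_card_le[OF _ sphere_subset]) auto
  also have "\<dots> = 2 * nat (2 * int r + 1)"
    by (simp add: card_cartesian_product)
  also have "\<dots> \<le> 6 * r"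
    using assms by simp
  finally show ?thesis .
qed

lemma edges_at_level_subset:
  "{e \<in> lattice_edges. edge_level e = r} \<subseteq> (\<Union>x\<in>{x. level x = r}. (\<lambda>z. {x, z}) ` neighbours x)"
proof
  fix e assume e: "e \<in> {e \<in> lattice_edges. edge_level e = r}"
  then obtain x y where xy: "e = {x, y}" "adjacent x y"
    by (auto simp: lattice_edges_def)
  show "e \<in> (\<Union>x\<in>{x. level x = r}. (\<lambda>z. {x, z}) ` neighbours x)"
  proof (cases "level x = r")
    case True
    then show ?thesis
      using xy by (intro UN_I[of x]) (auto simp: adjacent_iff_neighbours)
  next
    case False
    then have "level y = r"
      using e xy by (auto simp: max_def split: if_splits)
    moreover have "e = {y, x}" "x \<in> neighbours y"
      using xy adjacent_sym[of x y] by (auto simp: adjacent_iff_neighbours)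
    ultimately show ?thesis
      by blast
  qed
qed

lemma finite_edges_at_level: "finite {e \<in> lattice_edges. edge_level e = r}"
  by (rule finite_subset[OF edges_at_level_subset]) (auto simp: finite_sphere finite_neighbours)

lemma card_edges_at_level_le:
  assumes "1 \<le> r"
  shows "card {e \<in> lattice_edges. edge_level e = r} \<le> 24 * r"
proof -
  have "card {e \<in> lattice_edges. edge_level e = r}
      \<le> card (\<Union>x\<in>{x. level x = r}. (\<lambda>z. {x, z}) ` neighbours x)"
    by (rule card_mono[OF _ edges_at_level_subset]) (auto simp: finite_sphere finite_neighbours)
  also have "\<dots> \<le> (\<Sum>x\<in>{x. level x = r}. card ((\<lambda>z. {x, z}) ` neighbours x))"
    by (rule card_UN_le[OF finite_sphere])
  also have "\<dots> \<le> (\<Sum>x\<in>{x. level x = r}. 4)"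
    by (intro sum_mono order_trans[OF card_image_le[OF finite_neighbours] card_neighbours_le])
  also have "\<dots> \<le> 24 * r"
    using card_sphere_le[OF assms] by simp
  finally show ?thesis .
qed

text \<open>For \<open>1 \<le> k \<le> N\<close> this is \<open>1 / k - 1 / (N + 1)\<close>, the weight of an edge at level \<open>k\<close>.  Writing it as a sum
of positive coefficients indexed by \<open>r \<ge> k\<close> makes a weighted passage time a positive combination
of the passage times inside the balls of radius \<open>r\<close>, which is the summation by parts used
below.\<close>

definition level_weight :: "nat \<Rightarrow> nat \<Rightarrow> real" where
  "level_weight N k = (\<Sum>r = k..N. 1 / (real r * (real r + 1)))"

lemma level_weight_nonneg: "0 \<le> level_weight N k"
  unfolding level_weight_def by (intro sum_nonneg) auto

lemma level_weight_le:
  assumes "1 \<le> k"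
  shows "level_weight N k \<le> 1 / k"
proof (cases "k \<le> N")
  case True
  have "level_weight N k = (\<Sum>r = k..N. (- 1 / real (Suc r)) - (- 1 / real r))"
    unfolding level_weight_def using assms by (intro sum.cong) (auto simp: field_simps)
  also have "\<dots> = (- 1 / real (Suc N)) - (- 1 / real k)"
    using sum_Suc_diff[of k N "\<lambda>r. - 1 / real r"] True by simp
  also have "\<dots> \<le> 1 / k"
    by simp
  finally show ?thesis .
qed (simp add: level_weight_def)

lemma level_weight_eq_0: "N < k \<Longrightarrow> level_weight N k = 0"
  by (simp add: level_weight_def)

text \<open>Exchanging the two sums, the weighted time of \<open>p\<close> is the sum over \<open>r \<le> N\<close> of
\<open>1 / (r (r + 1))\<close> times the time that \<open>p\<close> spends on edges within level \<open>r\<close>.  By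
\<open>self_avoiding_crossing\<close> the latter is at least \<open>c r\<close> when \<open>r \<ge> r0\<close>, and what remains is
a harmonic sum.\<close>

lemma weighted_path_time_ge:
  assumes nonneg: "\<And>e. e \<in> lattice_edges \<Longrightarrow> 0 \<le> t e"
    and speed: "\<And>r q. r0 \<le> r \<Longrightarrow> q \<in> walks (0, 0) r \<Longrightarrow> distinct q \<Longrightarrow> c * real r \<le> path_time t q"
    and r0: "1 \<le> r0" and p: "lattice_path (0, 0) y p" and N: "N \<le> level y"
  shows "c * (\<Sum>r = r0..N. 1 / (real r + 1)) \<le> path_time (\<lambda>e. level_weight N (edge_level e) * t e) p"
proof -
  \<comment> \<open>The weights restricted to the ball of radius \<open>r\<close>.\<close>
  define u where "u r e = (if edge_level e \<le> r then t e else 0)" for r :: nat and e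
  have u_nonneg: "0 \<le> u r e" if "e \<in> lattice_edges" for r e
    using nonneg[OF that] by (simp add: u_def)
  have succ: "successively adjacent p"
    using p by (simp add: lattice_path_def)
  have crossing: "c * real r \<le> path_time (u r) p" if r: "r0 \<le> r" "r \<le> N" for r
  proof -
    obtain q where q: "q \<in> walks (0, 0) r" "distinct q" "\<forall>z\<in>set q. level z \<le> r"
      "path_time (u r) q \<le> path_time (u r) p"
      using self_avoiding_crossing[of y p r "u r"] p r N u_nonneg by force
    have "path_time (u r) q = path_time t q"
      unfolding path_time_def u_def using q(3) by (intro sum.cong) auto
    then show ?thesis
      using speed[OF r(1) q(1,2)] q(4) by simp
  qed
  have "path_time (\<lambda>e. level_weight N (edge_level e) * t e) p
      = path_time (\<lambda>e. \<Sum>r = 1..N. 1 / (real r * (real r + 1)) * u r e) p"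
    unfolding path_time_def
  proof (intro sum.cong refl)
    fix i assume "i \<in> {..<length p - 1}"
    then have "1 \<le> edge_level {p ! i, p ! Suc i}"
      by (intro edge_level_pos path_edge_in_lattice[OF succ]) auto
    then show "level_weight N (edge_level {p ! i, p ! Suc i}) * t {p ! i, p ! Suc i}
        = (\<Sum>r = 1..N. 1 / (real r * (real r + 1)) * u r {p ! i, p ! Suc i})"
      unfolding level_weight_def u_def sum_distrib_right
      by (intro sum.mono_neutral_cong_left) auto
  qed
  also have "\<dots> = (\<Sum>r = 1..N. 1 / (real r * (real r + 1)) * path_time (u r) p)"
    unfolding path_time_def sum_distrib_left by (rule sum.swap)
  also have "\<dots> \<ge> (\<Sum>r = r0..N. 1 / (real r * (real r + 1)) * path_time (u r) p)"
    using r0 path_time_nonneg[OF succ u_nonneg] by (intro sum_mono2) auto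
  also have "(\<Sum>r = r0..N. 1 / (real r * (real r + 1)) * path_time (u r) p)
      \<ge> (\<Sum>r = r0..N. 1 / (real r * (real r + 1)) * (c * real r))"
    using crossing by (intro sum_mono mult_left_mono) auto
  also have "(\<Sum>r = r0..N. 1 / (real r * (real r + 1)) * (c * real r)) = c * (\<Sum>r = r0..N. 1 / (real r + 1))"
    unfolding sum_distrib_left using r0 by (intro sum.cong) auto
  finally show ?thesis .
qed

lemma sum_inverse_ge_ln:
  assumes "1 \<le> r0" "1 \<le> N"
  shows "ln (real N) - ln (real r0 + 1) \<le> (\<Sum>r = r0..N. 1 / (real r + 1))"
proof (cases "r0 \<le> N")
  case True
  have "ln (real r + 2) - ln (real r + 1) \<le> 1 / (real r + 1)" for r
  proof -
    have "1 + 1 / (real r + 1) = (real r + 2) / (real r + 1)"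
      by (simp add: field_simps)
    then have "ln (real r + 2) - ln (real r + 1) = ln (1 + 1 / (real r + 1))"
      by (simp add: ln_div)
    then show ?thesis
      using ln_add_one_self_le_self[of "1 / (real r + 1)"] by simp
  qed
  then have "(\<Sum>r = r0..N. ln (real (Suc r) + 1) - ln (real r + 1)) \<le> (\<Sum>r = r0..N. 1 / (real r + 1))"
    by (intro sum_mono) (auto simp: add_ac)
  moreover have "(\<Sum>r = r0..N. ln (real (Suc r) + 1) - ln (real r + 1)) = ln (real (Suc N) + 1) - ln (real r0 + 1)"
    using True by (intro sum_Suc_diff) auto
  moreover have "ln (real N) \<le> ln (real (Suc N) + 1)"
    using assms by (subst ln_le_cancel_iff) auto
  ultimately show ?thesis
    by linarith
next
  case False
  then show ?thesis
    using assms by simp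
qed

definition edges_within :: "nat \<Rightarrow> vertex set set" where
  "edges_within N = {e \<in> lattice_edges. edge_level e \<le> N}"

lemma edges_within_eq: "edges_within N = (\<Union>r\<in>{1..N}. {e \<in> lattice_edges. edge_level e = r})"
  using edge_level_pos by (auto simp: edges_within_def)

lemma finite_edges_within: "finite (edges_within N)"
  unfolding edges_within_eq using finite_edges_at_level by blast

text \<open>The total cost of the perturbation: \<open>O(r)\<close> edges at level \<open>r\<close>, each with squared
weight at most \<open>1 / r\<^sup>2\<close>, give a harmonic sum.\<close>

lemma sum_level_weight_sq_le:
  assumes "1 \<le> N"
  shows "(\<Sum>e\<in>edges_within N. (level_weight N (edge_level e))\<^sup>2) \<le> 24 * (1 + ln (real N))"
proof -
  have "(\<Sum>e\<in>edges_within N. (level_weight N (edge_level e))\<^sup>2)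
      = (\<Sum>r = 1..N. \<Sum>e\<in>{e \<in> lattice_edges. edge_level e = r}. (level_weight N (edge_level e))\<^sup>2)"
    unfolding edges_within_eq using finite_edges_at_level by (intro sum.UNION_disjoint) auto
  also have "\<dots> \<le> (\<Sum>r = 1..N. 24 * (1 / real r))"
  proof (intro sum_mono)
    fix r assume "r \<in> {1..N}"
    then have r: "1 \<le> r"
      by simp
    have "(\<Sum>e\<in>{e \<in> lattice_edges. edge_level e = r}. (level_weight N (edge_level e))\<^sup>2)
        \<le> real (card {e \<in> lattice_edges. edge_level e = r}) * (1 / real r)\<^sup>2"
      using level_weight_le[OF r] level_weight_nonneg
      by (intro sum_bounded_above) (auto intro!: power_mono)
    also have "\<dots> \<le> real (24 * r) * (1 / real r)\<^sup>2"
      using card_edges_at_level_le[OF r] by (intro mult_right_mono) (auto simp del: of_nat_mult)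
    also have "\<dots> = 24 * (1 / real r)"
      using r by (simp add: power2_eq_square)
    finally show "(\<Sum>e\<in>{e \<in> lattice_edges. edge_level e = r}. (level_weight N (edge_level e))\<^sup>2)
        \<le> 24 * (1 / real r)" .
  qed
  also have "\<dots> = 24 * harm N"
    by (simp add: harm_def sum_distrib_left divide_inverse)
  also have "\<dots> \<le> 24 * (1 + ln (real N))"
    using decseqD[OF decseq_harm_diff_ln, of 0 "N - 1"] assms by (simp add: harm_expand)
  finally show ?thesis .
qed

section \<open>Two elementary estimates and the speed constant\<close>

text \<open>With \<open>\<theta> = 15\<close>, a self-avoiding walk of length \<open>r\<close> has
\<open>E (exp (- \<theta> S)) = (1 / 16) ^ r\<close> for its passage time \<open>S\<close>, so by Chernoff's bound it is
faster than \<open>min_speed * r\<close> with probability at most \<open>(2 / 16) ^ r\<close>.  This beats the number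
\<open>4 ^ r\<close> of walks.\<close>

definition min_speed :: real where
  "min_speed = ln 2 / 15"

lemma min_speed_pos: "0 < min_speed"
  by (simp add: min_speed_def)

text \<open>Each step in \<open>j\<close> raises the scaling factor \<open>1 / (1 - j b)\<close> by at least \<open>b\<close>, as the
denominators are at most one; this separates the perturbed first-passage times.\<close>

lemma inverse_one_minus_gap:
  fixes b :: real
  assumes "0 \<le> b" "i < j" "real j * b \<le> 1 / 4"
  shows "1 / (1 - real i * b) + b \<le> 1 / (1 - real j * b)"
proof -
  have ij: "real i * b + b \<le> real j * b"
    using assms mult_right_mono[of "real (Suc i)" "real j" b] by (simp add: algebra_simps)
  define u where "u = 1 - real i * b"
  define w where "w = 1 - real j * b"
  have u: "0 < u" "u \<le> 1" "w \<le> u - b" "3 / 4 \<le> w" "w \<le> 1"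
    using ij assms by (auto simp: u_def w_def)
  have "b * (u * w) \<le> b * 1"
    using assms u by (intro mult_left_mono mult_le_one) auto
  then have "w + b * (u * w) \<le> u"
    using u by simp
  then have "1 / u + b \<le> 1 / w"
    using u by (simp add: field_simps)
  then show ?thesis
    by (simp add: u_def w_def)
qed

text \<open>The left-hand side is the second moment of the density that rescales one exponential variable by
\<open>1 / (1 - b)\<close>.  It exceeds \<open>1\<close> only to second order in \<open>b\<close>.\<close>

lemma second_moment_factor_le:
  fixes b :: real
  assumes "0 \<le> b" "b \<le> 1 / 4"
  shows "(1 - b)\<^sup>2 / (2 * (1 - b) - 1) \<le> exp (2 * b\<^sup>2)"
proof -
  have "b\<^sup>2 * (4 * b) \<le> b\<^sup>2 * 1"
    using assms by (intro mult_left_mono) auto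
  then have "(1 - b)\<^sup>2 \<le> (1 + 2 * b\<^sup>2) * (2 * (1 - b) - 1)"
    by (simp add: power2_eq_square algebra_simps)
  then have "(1 - b)\<^sup>2 / (2 * (1 - b) - 1) \<le> 1 + 2 * b\<^sup>2"
    using assms by (simp add: pos_divide_le_eq)
  also have "\<dots> \<le> exp (2 * b\<^sup>2)"
    by (rule exp_ge_add_one_self)
  finally show ?thesis .
qed

section \<open>Change of measure for independent exponential passage times\<close>

locale exponential_edge_times = prob_space M for M :: "'a measure" +
  fixes t :: "vertex set \<Rightarrow> 'a \<Rightarrow> real"
  assumes nonneg: "\<And>e \<omega>. e \<in> lattice_edges \<Longrightarrow> \<omega> \<in> space M \<Longrightarrow> 0 \<le> t e \<omega>"
    and indep: "indep_vars (\<lambda>_. borel) t lattice_edges"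
    and exponential: "\<And>e. e \<in> lattice_edges \<Longrightarrow> distributed M lborel (t e) (exponential_density 1)"
begin

lemma edge_time_measurable [measurable]: "e \<in> lattice_edges \<Longrightarrow> t e \<in> borel_measurable M"
  using indep by (simp add: indep_vars_def)

text \<open>The weight \<open>k * exp ((1 - k) * x)\<close> is the ratio of the exponential densities of rates \<open>k\<close>
and \<open>1\<close>, and an exponential variable of mean 1 divided by \<open>k\<close> has rate \<open>k\<close>.\<close>

lemma nn_integral_tilt:
  assumes e: "e \<in> lattice_edges" and k: "0 < k" and g [measurable]: "g \<in> borel_measurable borel"
  shows "(\<integral>\<^sup>+\<omega>. ennreal (k * exp ((1 - k) * t e \<omega>)) * g (t e \<omega>) \<partial>M) = (\<integral>\<^sup>+\<omega>. g (t e \<omega> / k) \<partial>M)"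
proof -
  have "(\<integral>\<^sup>+\<omega>. ennreal (k * exp ((1 - k) * t e \<omega>)) * g (t e \<omega>) \<partial>M)
      = (\<integral>\<^sup>+x. ennreal (exponential_density 1 x) * (ennreal (k * exp ((1 - k) * x)) * g x) \<partial>lborel)"
    by (rule distributed_nn_integral[OF exponential[OF e], symmetric]) simp
  also have "\<dots> = (\<integral>\<^sup>+x. ennreal (exponential_density k x) * g x \<partial>lborel)"
  proof (rule nn_integral_cong)
    fix x :: real
    have "exponential_density 1 x * (k * exp ((1 - k) * x)) = exponential_density k x"
      by (simp add: exponential_density_def mult_exp_exp algebra_simps)
    then show "ennreal (exponential_density 1 x) * (ennreal (k * exp ((1 - k) * x)) * g x)
        = ennreal (exponential_density k x) * g x"
      using k by (simp add: mult.assoc[symmetric] ennreal_mult[symmetric])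
  qed
  also have "\<dots> = (\<integral>\<^sup>+\<omega>. g (t e \<omega> / k) \<partial>M)"
  proof -
    have "distributed M lborel (\<lambda>\<omega>. 1 / k * t e \<omega>) (exponential_density k)"
      using erlang_distributed_mult_const[OF exponential[OF e], of "1 / k"] k by simp
    from distributed_nn_integral[OF this, of g] show ?thesis
      by simp
  qed
  finally show ?thesis .
qed

lemma nn_integral_exp_edge_time:
  assumes "e \<in> lattice_edges" "0 < k"
  shows "(\<integral>\<^sup>+\<omega>. ennreal (exp ((1 - k) * t e \<omega>)) \<partial>M) = ennreal (1 / k)"
proof -
  have "ennreal k * (\<integral>\<^sup>+\<omega>. ennreal (exp ((1 - k) * t e \<omega>)) \<partial>M) = 1"
    using nn_integral_tilt[OF assms, of "\<lambda>_. 1"] assms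
    by (simp add: ennreal_mult nn_integral_cmult emeasure_space_1)
  then have "ennreal (1 / k) * (ennreal k * (\<integral>\<^sup>+\<omega>. ennreal (exp ((1 - k) * t e \<omega>)) \<partial>M)) = ennreal (1 / k)"
    by simp
  then show ?thesis
    using assms by (simp add: mult.assoc[symmetric] ennreal_mult[symmetric])
qed

lemma nn_integral_prod_edges:
  fixes g :: "vertex set \<Rightarrow> real \<Rightarrow> ennreal"
  assumes F: "finite F" "F \<subseteq> lattice_edges" and g: "\<And>e. e \<in> F \<Longrightarrow> g e \<in> borel_measurable borel"
  shows "(\<integral>\<^sup>+\<omega>. (\<Prod>e\<in>F. g e (t e \<omega>)) \<partial>M) = (\<Prod>e\<in>F. \<integral>\<^sup>+\<omega>. g e (t e \<omega>) \<partial>M)"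
  using F(1) indep_vars_compose2[OF indep_vars_subset[OF indep F(2)], of g "\<lambda>_. borel"] g
  by (intro indep_vars_nn_integral) auto

text \<open>The density of the law of the configuration with \<open>t e\<close> replaced by \<open>t e / k e\<close> on
\<open>F\<close>, evaluated at the original configuration.\<close>

definition likelihood :: "(vertex set \<Rightarrow> real) \<Rightarrow> vertex set set \<Rightarrow> 'a \<Rightarrow> real" where
  "likelihood k F \<omega> = (\<Prod>e\<in>F. k e * exp ((1 - k e) * t e \<omega>))"

lemma likelihood_measurable [measurable]:
  "F \<subseteq> lattice_edges \<Longrightarrow> likelihood k F \<in> borel_measurable M"
  unfolding likelihood_def by (intro borel_measurable_prod) auto

lemma likelihood_nonneg: "(\<And>e. 0 < k e) \<Longrightarrow> 0 \<le> likelihood k F \<omega>"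
  unfolding likelihood_def by (intro prod_nonneg) (auto simp: less_imp_le)

lemma ennreal_likelihood:
  "(\<And>e. 0 < k e) \<Longrightarrow> ennreal (likelihood k F \<omega>) = (\<Prod>e\<in>F. ennreal (k e * exp ((1 - k e) * t e \<omega>)))"
  unfolding likelihood_def by (intro prod_ennreal[symmetric]) (auto simp: less_imp_le)

lemma nn_integral_likelihood_sq:
  assumes F: "finite F" "F \<subseteq> lattice_edges" and k: "\<And>e. 1 / 2 < k e"
  shows "(\<integral>\<^sup>+\<omega>. ennreal ((likelihood k F \<omega>)\<^sup>2) \<partial>M) = ennreal (\<Prod>e\<in>F. (k e)\<^sup>2 / (2 * k e - 1))"
proof -
  have pos: "0 < k e" "0 \<le> 2 * k e - 1" "0 < 2 * k e - 1" for e
    using k[of e] by auto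
  have "ennreal ((likelihood k F \<omega>)\<^sup>2)
      = (\<Prod>e\<in>F. ennreal ((k e)\<^sup>2) * ennreal (exp ((1 - (2 * k e - 1)) * t e \<omega>)))" for \<omega>
  proof -
    have "(likelihood k F \<omega>)\<^sup>2 = (\<Prod>e\<in>F. (k e)\<^sup>2 * exp ((1 - (2 * k e - 1)) * t e \<omega>))"
      unfolding likelihood_def prod_power_distrib
      by (intro prod.cong refl) (simp add: power_mult_distrib exp_double[symmetric] algebra_simps)
    also have "ennreal \<dots> = (\<Prod>e\<in>F. ennreal ((k e)\<^sup>2 * exp ((1 - (2 * k e - 1)) * t e \<omega>)))"
      by (intro prod_ennreal[symmetric]) auto
    finally show ?thesis
      by (simp add: ennreal_mult)
  qed
  then have "(\<integral>\<^sup>+\<omega>. ennreal ((likelihood k F \<omega>)\<^sup>2) \<partial>M)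
      = (\<integral>\<^sup>+\<omega>. (\<Prod>e\<in>F. ennreal ((k e)\<^sup>2) * ennreal (exp ((1 - (2 * k e - 1)) * t e \<omega>))) \<partial>M)"
    by simp
  also have "\<dots> = (\<Prod>e\<in>F. \<integral>\<^sup>+\<omega>. ennreal ((k e)\<^sup>2) * ennreal (exp ((1 - (2 * k e - 1)) * t e \<omega>)) \<partial>M)"
    using F by (intro nn_integral_prod_edges) auto
  also have "\<dots> = (\<Prod>e\<in>F. ennreal ((k e)\<^sup>2 / (2 * k e - 1)))"
  proof (intro prod.cong refl)
    fix e assume "e \<in> F"
    then have e: "e \<in> lattice_edges"
      using F by auto
    have "(\<integral>\<^sup>+\<omega>. ennreal ((k e)\<^sup>2) * ennreal (exp ((1 - (2 * k e - 1)) * t e \<omega>)) \<partial>M)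
        = ennreal ((k e)\<^sup>2) * ennreal (1 / (2 * k e - 1))"
      unfolding nn_integral_exp_edge_time[OF e pos(3), symmetric]
      using e by (intro nn_integral_cmult) auto
    then show "(\<integral>\<^sup>+\<omega>. ennreal ((k e)\<^sup>2) * ennreal (exp ((1 - (2 * k e - 1)) * t e \<omega>)) \<partial>M)
        = ennreal ((k e)\<^sup>2 / (2 * k e - 1))"
      using pos[of e] by (simp add: ennreal_mult[symmetric])
  qed
  also have "\<dots> = ennreal (\<Prod>e\<in>F. (k e)\<^sup>2 / (2 * k e - 1))"
    using pos by (intro prod_ennreal) auto
  finally show ?thesis .
qed

abbreviation configurations :: "(vertex set \<Rightarrow> real) measure" where
  "configurations \<equiv> Pi\<^sub>M lattice_edges (\<lambda>_. borel)"

lemma scaled_configuration_measurable [measurable]: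
  "(\<lambda>\<omega>. \<lambda>e\<in>lattice_edges. t e \<omega> / k e) \<in> measurable M configurations"
  by (intro measurable_restrict borel_measurable_divide edge_time_measurable) auto

lemma configuration_measurable [measurable]:
  "(\<lambda>\<omega>. \<lambda>e\<in>lattice_edges. t e \<omega>) \<in> measurable M configurations"
  by (intro measurable_restrict edge_time_measurable) auto

text \<open>Both measures live on the infinite product over all edges, where they are determined by
cylinder sets.  On a cylinder over \<open>J\<close>, independence factorises both sides over the finite set
\<open>F \<union> J\<close>, and \<open>nn_integral_tilt\<close> matches the factors.\<close>

lemma density_likelihood_distr:
  assumes F: "finite F" "F \<subseteq> lattice_edges" and k: "\<And>e. 0 < k e" and off: "\<And>e. e \<notin> F \<Longrightarrow> k e = 1"
  shows "distr (density M (likelihood k F)) configurations (\<lambda>\<omega>. \<lambda>e\<in>lattice_edges. t e \<omega>)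
    = distr M configurations (\<lambda>\<omega>. \<lambda>e\<in>lattice_edges. t e \<omega> / k e)" (is "?P = ?Q")
proof (rule measure_eqI_PiM_infinite[symmetric])
  show "finite_measure ?Q"
    by (rule finite_measure_distr) measurable
  fix A J
  assume J: "finite J" "J \<subseteq> lattice_edges" and A: "\<And>e. e \<in> J \<Longrightarrow> A e \<in> sets (borel :: real measure)"
  let ?S = "prod_emb lattice_edges (\<lambda>_. borel) J (Pi\<^sub>E J A) :: (vertex set \<Rightarrow> real) set"
  \<comment> \<open>The factor 1 off \<open>J\<close> lets both products run over \<open>F \<union> J\<close>.\<close>
  define g where "g e x = (if e \<in> J then indicator (A e) x else 1 :: ennreal)" for e and x :: real
  have g [measurable]: "g e \<in> borel_measurable borel" for e
    using A[of e] by (cases "e \<in> J") (auto simp: g_def[abs_def])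
  have S [measurable]: "?S \<in> sets configurations"
    using J A by (intro sets_PiM_I) auto
  have FJ: "finite (F \<union> J)" "F \<union> J \<subseteq> lattice_edges"
    using F J by auto
  have ind: "indicator ?S (\<lambda>e\<in>lattice_edges. x e) = (\<Prod>e\<in>F \<union> J. g e (x e))" for x :: "vertex set \<Rightarrow> real"
  proof -
    have "(\<Prod>e\<in>F \<union> J. g e (x e)) = (\<Prod>e\<in>J. indicator (A e) (x e) :: ennreal)"
      using FJ by (intro prod.mono_neutral_cong_right) (auto simp: g_def)
    also have "\<dots> = indicator ?S (\<lambda>e\<in>lattice_edges. x e)"
    proof (cases "\<forall>e\<in>J. x e \<in> A e")
      case True
      then have "(\<lambda>e\<in>lattice_edges. x e) \<in> ?S"
        using J by (auto simp: prod_emb_def PiE_iff)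
      with True show ?thesis
        by simp
    next
      case False
      then have "(\<lambda>e\<in>lattice_edges. x e) \<notin> ?S"
        using J by (auto simp: prod_emb_def PiE_iff)
      moreover have "(\<Prod>e\<in>J. indicator (A e) (x e) :: ennreal) = 0"
        using J False by (intro prod_zero) (auto simp: indicator_def)
      ultimately show ?thesis
        by simp
    qed
    finally show ?thesis ..
  qed
  have "emeasure ?P ?S = (\<integral>\<^sup>+\<omega>. ennreal (likelihood k F \<omega>) * indicator ?S (\<lambda>e\<in>lattice_edges. t e \<omega>) \<partial>M)"
    using F by (simp add: nn_integral_indicator[symmetric] nn_integral_distr nn_integral_density del: nn_integral_indicator)
  also have "\<dots> = (\<integral>\<^sup>+\<omega>. (\<Prod>e\<in>F \<union> J. ennreal (k e * exp ((1 - k e) * t e \<omega>)) * g e (t e \<omega>)) \<partial>M)"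
  proof (intro nn_integral_cong)
    fix \<omega>
    have "ennreal (likelihood k F \<omega>) = (\<Prod>e\<in>F \<union> J. ennreal (k e * exp ((1 - k e) * t e \<omega>)))"
      unfolding ennreal_likelihood[OF k] using FJ off by (intro prod.mono_neutral_left) auto
    then show "ennreal (likelihood k F \<omega>) * indicator ?S (\<lambda>e\<in>lattice_edges. t e \<omega>)
        = (\<Prod>e\<in>F \<union> J. ennreal (k e * exp ((1 - k e) * t e \<omega>)) * g e (t e \<omega>))"
      by (simp only: ind prod.distrib)
  qed
  also have "\<dots> = (\<Prod>e\<in>F \<union> J. \<integral>\<^sup>+\<omega>. ennreal (k e * exp ((1 - k e) * t e \<omega>)) * g e (t e \<omega>) \<partial>M)"
    using FJ by (intro nn_integral_prod_edges) auto
  also have "\<dots> = (\<Prod>e\<in>F \<union> J. \<integral>\<^sup>+\<omega>. g e (t e \<omega> / k e) \<partial>M)"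
    using FJ k by (intro prod.cong refl nn_integral_tilt) auto
  also have "\<dots> = (\<integral>\<^sup>+\<omega>. (\<Prod>e\<in>F \<union> J. g e (t e \<omega> / k e)) \<partial>M)"
    using FJ by (intro nn_integral_prod_edges[symmetric]) auto
  also have "\<dots> = (\<integral>\<^sup>+\<omega>. indicator ?S (\<lambda>e\<in>lattice_edges. t e \<omega> / k e) \<partial>M)"
    by (simp only: ind)
  also have "\<dots> = emeasure ?Q ?S"
    by (simp add: nn_integral_indicator[symmetric] nn_integral_distr del: nn_integral_indicator)
  finally show "emeasure ?Q ?S = emeasure ?P ?S" ..
qed simp_all

text \<open>The two probabilities differ by \<open>E ((1 - L) 1\<^sub>B)\<close>, where the likelihood \<open>L\<close> has mean 1 and
variance at most \<open>\<eta>\<^sup>2\<close>.\<close>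

lemma prob_le_prob_scaled:
  assumes F: "finite F" "F \<subseteq> lattice_edges" and k: "\<And>e. 1 / 2 < k e" and off: "\<And>e. e \<notin> F \<Longrightarrow> k e = 1"
    and \<eta>: "0 < \<eta>" and second: "(\<Prod>e\<in>F. (k e)\<^sup>2 / (2 * k e - 1)) \<le> 1 + \<eta>\<^sup>2"
    and S [measurable]: "S \<in> sets configurations"
  shows "prob {\<omega>\<in>space M. (\<lambda>e\<in>lattice_edges. t e \<omega>) \<in> S}
    \<le> prob {\<omega>\<in>space M. (\<lambda>e\<in>lattice_edges. t e \<omega> / k e) \<in> S} + \<eta>"
proof -
  let ?L = "likelihood k F"
  have kpos: "0 < k e" for e
    using k[of e] by auto
  have Lm [measurable]: "?L \<in> borel_measurable M"
    using F by simp
  define B where "B = {\<omega>\<in>space M. (\<lambda>e\<in>lattice_edges. t e \<omega>) \<in> S}"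
  define B' where "B' = {\<omega>\<in>space M. (\<lambda>e\<in>lattice_edges. t e \<omega> / k e) \<in> S}"
  have B_sets [measurable]: "B \<in> events" "B' \<in> events"
    unfolding B_def B'_def by measurable
  have shifted: "(\<integral>\<^sup>+\<omega>. ennreal (?L \<omega> * indicator B \<omega>) \<partial>M) = ennreal (prob B')"
  proof -
    have "ennreal (prob B') = emeasure (distr M configurations (\<lambda>\<omega>. \<lambda>e\<in>lattice_edges. t e \<omega> / k e)) S"
      by (simp add: emeasure_distr emeasure_eq_measure[symmetric] B'_def vimage_def Int_def conj_commute)
    also have "\<dots> = emeasure (distr (density M ?L) configurations (\<lambda>\<omega>. \<lambda>e\<in>lattice_edges. t e \<omega>)) S"
      using density_likelihood_distr[OF F kpos off] by simp
    also have "\<dots> = emeasure (density M ?L) B"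
      by (simp add: emeasure_distr B_def vimage_def Int_def conj_commute)
    also have "\<dots> = (\<integral>\<^sup>+\<omega>. ennreal (?L \<omega> * indicator B \<omega>) \<partial>M)"
      by (auto simp: emeasure_density intro!: nn_integral_cong split: split_indicator)
    finally show ?thesis ..
  qed
  have total: "(\<integral>\<^sup>+\<omega>. ennreal (?L \<omega>) \<partial>M) = 1"
  proof -
    have "(\<integral>\<^sup>+\<omega>. ennreal (?L \<omega>) \<partial>M) = emeasure (density M ?L) (space M)"
      by (simp add: emeasure_density)
    also have "\<dots> = emeasure (distr (density M ?L) configurations (\<lambda>\<omega>. \<lambda>e\<in>lattice_edges. t e \<omega>)) (space configurations)"
    proof -
      have "(\<lambda>\<omega>. \<lambda>e\<in>lattice_edges. t e \<omega>) -` space configurations \<inter> space M = space M"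
        using measurable_space[OF configuration_measurable] by auto
      then show ?thesis
        by (simp add: emeasure_distr)
    qed
    also have "\<dots> = emeasure (distr M configurations (\<lambda>\<omega>. \<lambda>e\<in>lattice_edges. t e \<omega> / k e)) (space configurations)"
      using density_likelihood_distr[OF F kpos off] by simp
    also have "\<dots> = 1"
      using prob_space.emeasure_space_1[OF prob_space_distr[OF scaled_configuration_measurable[of k]]] by simp
    finally show ?thesis .
  qed
  have Lnn: "0 \<le> ?L \<omega>" for \<omega>
    using likelihood_nonneg kpos by simp
  have intL: "integrable M ?L" "(\<integral>\<omega>. ?L \<omega> \<partial>M) = 1"
    using total Lnn by (auto intro!: integrableI_nonneg simp: integral_eq_nn_integral)
  have L2: "(\<integral>\<^sup>+\<omega>. ennreal ((?L \<omega>)\<^sup>2) \<partial>M) \<le> ennreal (1 + \<eta>\<^sup>2)"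
    unfolding nn_integral_likelihood_sq[OF F k] using second by (rule ennreal_leI)
  have intL2: "integrable M (\<lambda>\<omega>. (?L \<omega>)\<^sup>2)"
    using L2 by (intro integrableI_nonneg) (auto intro: le_less_trans)
  have L2': "(\<integral>\<omega>. (?L \<omega>)\<^sup>2 \<partial>M) \<le> 1 + \<eta>\<^sup>2"
    using L2 nn_integral_eq_integral[OF intL2] ennreal_le_iff[of "1 + \<eta>\<^sup>2"] by (simp del: ennreal_plus)
  have intLB: "integrable M (\<lambda>\<omega>. ?L \<omega> * indicator B \<omega>)"
    using integrable_mult_indicator[OF B_sets(1) intL(1)] by (simp add: mult.commute)
  have "(\<integral>\<omega>. ?L \<omega> * indicator B \<omega> \<partial>M) = prob B'"
    using shifted Lnn nn_integral_eq_integral[OF intLB] by (simp add: ennreal_inj integral_nonneg_AE)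
  then have "prob B - prob B' = (\<integral>\<omega>. indicator B \<omega> - ?L \<omega> * indicator B \<omega> \<partial>M)"
    using intLB by (subst Bochner_Integration.integral_diff) (auto simp: integrable_indicator_iff emeasure_eq_measure)
  also have "\<dots> \<le> (\<integral>\<omega>. \<eta> / 2 + (1 - 2 * ?L \<omega> + (?L \<omega>)\<^sup>2) / (2 * \<eta>) \<partial>M)"
  proof (rule integral_mono)
    fix \<omega>
    \<comment> \<open>The arithmetic-geometric mean inequality replaces Cauchy-Schwarz: with \<open>x = 1 - L\<close>,
      \<open>x \<le> \<eta> / 2 + x\<^sup>2 / (2 \<eta>)\<close>, and the expectation of the right-hand side is at most \<open>\<eta>\<close>.\<close>
    have "(\<eta> - (1 - ?L \<omega>))\<^sup>2 \<ge> 0"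
      by simp
    then have "2 * \<eta> * (1 - ?L \<omega>) \<le> \<eta>\<^sup>2 + (1 - 2 * ?L \<omega> + (?L \<omega>)\<^sup>2)"
      by (simp add: power2_eq_square algebra_simps)
    then have "1 - ?L \<omega> \<le> \<eta> / 2 + (1 - 2 * ?L \<omega> + (?L \<omega>)\<^sup>2) / (2 * \<eta>)"
      using \<eta> by (simp add: field_simps power2_eq_square)
    moreover have "0 \<le> \<eta> / 2 + (1 - 2 * ?L \<omega> + (?L \<omega>)\<^sup>2) / (2 * \<eta>)"
    proof -
      have "1 - 2 * ?L \<omega> + (?L \<omega>)\<^sup>2 = (1 - ?L \<omega>)\<^sup>2"
        by (simp add: power2_eq_square algebra_simps)
      then show ?thesis
        using \<eta> by simp
    qed
    ultimately show "indicator B \<omega> - ?L \<omega> * indicator B \<omega> \<le> \<eta> / 2 + (1 - 2 * ?L \<omega> + (?L \<omega>)\<^sup>2) / (2 * \<eta>)"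
      by (auto split: split_indicator)
  qed (use intLB intL intL2 in \<open>auto simp: integrable_indicator_iff emeasure_eq_measure\<close>)
  also have "\<dots> = \<eta> / 2 + ((\<integral>\<omega>. (?L \<omega>)\<^sup>2 \<partial>M) - 1) / (2 * \<eta>)"
    using intL intL2 by (simp add: prob_space)
  also have "\<dots> \<le> \<eta> / 2 + \<eta>\<^sup>2 / (2 * \<eta>)"
    using L2' \<eta> by (intro add_left_mono divide_right_mono) auto
  also have "\<dots> = \<eta>"
    using \<eta> by (simp add: power2_eq_square)
  finally show ?thesis
    by (simp add: B_def B'_def)
qed

section \<open>Linear growth along self-avoiding walks\<close>

lemma path_time_times_measurable [measurable]:
  assumes "successively adjacent p"
  shows "(\<lambda>\<omega>. path_time (\<lambda>e. t e \<omega>) p) \<in> borel_measurable M"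
  unfolding path_time_def using path_edge_in_lattice[OF assms]
  by (intro borel_measurable_sum edge_time_measurable) auto

lemma first_passage_scaled_measurable [measurable]:
  "(\<lambda>\<omega>. first_passage_time (\<lambda>e. t e \<omega> / k e) x y) \<in> borel_measurable M"
  using measurable_compose[OF scaled_configuration_measurable[of k] first_passage_time_measurable[of x y]]
  by (simp add: first_passage_time_restrict)

lemma first_passage_measurable [measurable]:
  "(\<lambda>\<omega>. first_passage_time (\<lambda>e. t e \<omega>) x y) \<in> borel_measurable M"
  using first_passage_scaled_measurable[of "\<lambda>_. 1" x y] by simp

text \<open>Chernoff's bound with the exponent \<open>15\<close> built into \<open>min_speed\<close>.\<close>

lemma prob_fast_walk_le:
  assumes q: "q \<in> walks x r" "distinct q"
  shows "prob {\<omega>\<in>space M. path_time (\<lambda>e. t e \<omega>) q < min_speed * real r} \<le> (1 / 8) ^ r"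
proof -
  from q obtain F where F: "finite F" "F \<subseteq> lattice_edges" "card F = r" "\<And>t. path_time t q = sum t F"
    by (rule path_time_eq_sum_edges) blast
  have [measurable]: "(\<lambda>\<omega>. path_time (\<lambda>e. t e \<omega>) q) \<in> borel_measurable M"
    using q by (intro path_time_times_measurable) (simp add: walks_def)
  let ?A = "{\<omega>\<in>space M. path_time (\<lambda>e. t e \<omega>) q < min_speed * real r}"
  have "ennreal (prob ?A) = (\<integral>\<^sup>+\<omega>. indicator ?A \<omega> \<partial>M)"
    by (simp add: emeasure_eq_measure)
  also have "\<dots> \<le> (\<integral>\<^sup>+\<omega>. ennreal (2 ^ r) * (\<Prod>e\<in>F. ennreal (exp ((1 - 16) * t e \<omega>))) \<partial>M)"
  proof (rule nn_integral_mono)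
    fix \<omega>
    have "indicator ?A \<omega> \<le> exp (15 * (min_speed * real r - path_time (\<lambda>e. t e \<omega>) q))"
      by (auto split: split_indicator)
    also have "\<dots> = exp (real r * ln 2) * exp (\<Sum>e\<in>F. (1 - 16) * t e \<omega>)"
      by (simp add: min_speed_def F(4) mult_exp_exp sum_distrib_left algebra_simps sum_negf)
    also have "\<dots> = 2 ^ r * (\<Prod>e\<in>F. exp ((1 - 16) * t e \<omega>))"
      using F(1) by (simp add: exp_of_nat_mult exp_sum)
    finally have "ennreal (indicator ?A \<omega>) \<le> ennreal (2 ^ r * (\<Prod>e\<in>F. exp ((1 - 16) * t e \<omega>)))"
      by (rule ennreal_leI)
    then show "indicator ?A \<omega> \<le> ennreal (2 ^ r) * (\<Prod>e\<in>F. ennreal (exp ((1 - 16) * t e \<omega>)))"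
      by (simp add: ennreal_mult prod_nonneg prod_ennreal ennreal_indicator)
  qed
  also have "\<dots> = ennreal (2 ^ r) * (\<integral>\<^sup>+\<omega>. (\<Prod>e\<in>F. ennreal (exp ((1 - 16) * t e \<omega>))) \<partial>M)"
    using F by (intro nn_integral_cmult borel_measurable_prod_ennreal) auto
  also have "\<dots> = ennreal (2 ^ r) * (\<Prod>e\<in>F. \<integral>\<^sup>+\<omega>. ennreal (exp ((1 - 16) * t e \<omega>)) \<partial>M)"
    using F by (subst nn_integral_prod_edges) auto
  also have "\<dots> = ennreal (2 ^ r) * (\<Prod>e\<in>F. ennreal (1 / 16))"
    using F(2) nn_integral_exp_edge_time[of _ 16] by (intro arg_cong2[of _ _ _ _ "(*)"] prod.cong) auto
  also have "\<dots> = ennreal (2 ^ r * (1 / 16) ^ r)"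
    using F(3) by (simp add: ennreal_mult ennreal_power)
  also have "2 ^ r * (1 / 16) ^ r = (1 / 8 :: real) ^ r"
    by (simp add: power_mult_distrib[symmetric])
  finally show ?thesis
    by simp
qed

definition fast_walk_from :: "nat \<Rightarrow> 'a set" where
  "fast_walk_from r0 = {\<omega>\<in>space M. \<exists>r\<ge>r0. \<exists>q\<in>walks (0, 0) r.
    distinct q \<and> path_time (\<lambda>e. t e \<omega>) q < min_speed * real r}"

text \<open>A union bound: at most \<open>4 ^ r\<close> walks of length \<open>r\<close>, each fast with probability at most
\<open>(1 / 8) ^ r\<close>, and then a geometric series over \<open>r \<ge> r0\<close>.\<close>

lemma
  shows fast_walk_from_events [measurable]: "fast_walk_from r0 \<in> events"
    and prob_fast_walk_from_le: "prob (fast_walk_from r0) \<le> 2 * (1 / 2) ^ r0"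
proof -
  define W where "W r = {q \<in> walks (0, 0) r. distinct q}" for r
  define A where "A r q = {\<omega>\<in>space M. path_time (\<lambda>e. t e \<omega>) q < min_speed * real r}" for r :: nat and q
  define B where "B r = (\<Union>q\<in>W r. A r q)" for r
  have finW: "finite (W r)" for r
    using finite_walks by (simp add: W_def)
  have A_meas: "A r q \<in> events" if "q \<in> W r" for r q
  proof -
    have [measurable]: "(\<lambda>\<omega>. path_time (\<lambda>e. t e \<omega>) q) \<in> borel_measurable M"
      using that by (intro path_time_times_measurable) (simp add: W_def walks_def)
    show ?thesis
      unfolding A_def by measurable
  qed
  have B_meas [measurable]: "B r \<in> events" for r
    unfolding B_def using finW A_meas by blast
  have B_le: "prob (B r) \<le> (1 / 2) ^ r" for r
  proof -
    have "prob (B r) \<le> (\<Sum>q\<in>W r. prob (A r q))"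
      unfolding B_def using finW A_meas by (intro finite_measure_subadditive_finite) auto
    also have "\<dots> \<le> (\<Sum>q\<in>W r. (1 / 8) ^ r)"
      unfolding A_def W_def by (intro sum_mono prob_fast_walk_le) auto
    also have "\<dots> = real (card (W r)) * (1 / 8) ^ r"
      by simp
    also have "\<dots> \<le> real (4 ^ r) * (1 / 8) ^ r"
    proof (intro mult_right_mono of_nat_mono)
      show "card (W r) \<le> 4 ^ r"
        using card_mono[OF finite_walks, of "W r"] card_walks_le[of "(0, 0)" r]
        by (auto simp: W_def intro: order_trans)
    qed auto
    also have "\<dots> = (1 / 2) ^ r"
      by (simp add: power_mult_distrib[symmetric])
    finally show ?thesis .
  qed
  have eq: "fast_walk_from r0 = (\<Union>i. B (r0 + i))"
  proof
    show "fast_walk_from r0 \<subseteq> (\<Union>i. B (r0 + i))"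
    proof
      fix \<omega> assume "\<omega> \<in> fast_walk_from r0"
      then obtain r where "r0 \<le> r" "\<omega> \<in> B r"
        by (auto simp: fast_walk_from_def B_def A_def W_def)
      then show "\<omega> \<in> (\<Union>i. B (r0 + i))"
        by (intro UN_I[of "r - r0"]) auto
    qed
  qed (auto simp: fast_walk_from_def B_def A_def W_def intro!: exI[of _ "r0 + _"])
  show "fast_walk_from r0 \<in> events"
    unfolding eq by measurable
  have sums: "(\<lambda>i. (1 / 2 :: real) ^ (r0 + i)) sums (2 * (1 / 2) ^ r0)"
    using sums_mult[OF geometric_sums[of "1 / 2 :: real"], of "(1 / 2) ^ r0"] by (simp add: power_add mult.commute)
  have summ: "summable (\<lambda>i. prob (B (r0 + i)))"
    using B_le by (intro summable_comparison_test'[OF sums_summable[OF sums]]) auto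
  have "prob (fast_walk_from r0) \<le> (\<Sum>i. prob (B (r0 + i)))"
    unfolding eq using summ by (intro finite_measure_subadditive_countably) auto
  also have "\<dots> \<le> (\<Sum>i. (1 / 2) ^ (r0 + i))"
    using B_le by (intro suminf_le summ sums_summable[OF sums])
  also have "\<dots> = 2 * (1 / 2) ^ r0"
    using sums by (rule sums_unique[symmetric])
  finally show "prob (fast_walk_from r0) \<le> 2 * (1 / 2) ^ r0" .
qed

text \<open>Off the exceptional event, \<open>weighted_path_time_ge\<close> applies simultaneously to all paths ending
at \<open>y\<close>.\<close>

lemma weighted_path_time_ge_ln:
  assumes \<omega>: "\<omega> \<in> space M" "\<omega> \<notin> fast_walk_from r0" and r0: "1 \<le> r0" and y: "1 \<le> level y"
    and p: "lattice_path (0, 0) y p"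
  shows "min_speed * (ln (real (level y)) - ln (real r0 + 1))
    \<le> path_time (\<lambda>e. level_weight (level y) (edge_level e) * t e \<omega>) p"
proof -
  have "min_speed * (ln (real (level y)) - ln (real r0 + 1)) \<le> min_speed * (\<Sum>r = r0..level y. 1 / (real r + 1))"
    using sum_inverse_ge_ln[OF r0 y] min_speed_pos by (intro mult_left_mono) auto
  also have "\<dots> \<le> path_time (\<lambda>e. level_weight (level y) (edge_level e) * t e \<omega>) p"
    by (rule weighted_path_time_ge[OF _ _ r0 p])
      (use \<omega> nonneg in \<open>auto simp: fast_walk_from_def not_less\<close>)
  finally show ?thesis .
qed

section \<open>Anti-concentration\<close>

text \<open>The core of the argument.  The times \<open>T j\<close> with \<open>j < K\<close> are pairwise further apart
than \<open>b - a\<close> off \<open>fast_walk_from r0\<close>, so at most one of them is in the interval.  Each of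
them is there with probability at least that of the original time minus \<open>\<eta>\<close>.  Summing over
\<open>j\<close> and dividing by \<open>K\<close> gives the bound.\<close>

lemma prob_first_passage_interval_le:
  assumes \<alpha>: "0 < \<alpha>" "real K * \<alpha> \<le> 1 / 4"
    and \<eta>: "0 < \<eta>" "48 * (real K * \<alpha>)\<^sup>2 \<le> ln (1 + \<eta>\<^sup>2)"
    and K: "1 \<le> K" and r0: "1 \<le> r0" and y: "1 \<le> level y"
    and ab: "b - a < \<alpha> / sqrt (1 + ln (real (level y))) *
      (min_speed * (ln (real (level y)) - ln (real r0 + 1)))"
  shows "prob {\<omega>\<in>space M. first_passage_time (\<lambda>e. t e \<omega>) (0, 0) y \<in> {a..b}}
    \<le> 1 / real K + prob (fast_walk_from r0) + \<eta>"
proof -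
  define N where "N = level y"
  define F where "F = edges_within N"
  define \<beta> where "\<beta> e = (if e \<in> F then \<alpha> / sqrt (1 + ln (real N)) * level_weight N (edge_level e) else 0)" for e
  define k where "k j e = 1 - real j * \<beta> e" for j :: nat and e
  define T where "T j \<omega> = first_passage_time (\<lambda>e. t e \<omega> / k j e) (0, 0) y" for j \<omega>
  define A where "A j = {\<omega>\<in>space M. T j \<omega> \<in> {a..b}}" for j
  define G where "G = fast_walk_from r0"
  have F: "finite F" "F \<subseteq> lattice_edges"
    using finite_edges_within by (auto simp: F_def edges_within_def)
  have lnN: "0 \<le> ln (real N)" "1 \<le> N"
    using y by (auto simp: N_def)
  then have lnN': "1 \<le> 1 + ln (real N)" "0 < 1 + ln (real N)"
    by linarith+
  have \<beta>: "0 \<le> \<beta> e" "\<beta> e \<le> \<alpha>" for e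
  proof -
    show "0 \<le> \<beta> e"
      using \<alpha> lnN level_weight_nonneg by (simp add: \<beta>_def)
    show "\<beta> e \<le> \<alpha>"
    proof (cases "e \<in> F")
      case True
      then have e: "1 \<le> edge_level e"
        using F edge_level_pos by auto
      have "level_weight N (edge_level e) \<le> 1 / real (edge_level e)"
        by (rule level_weight_le[OF e])
      also have "\<dots> \<le> 1"
        using e by simp
      finally have "level_weight N (edge_level e) \<le> 1" .
      moreover have "\<alpha> / sqrt (1 + ln (real N)) \<le> \<alpha> / 1"
        using \<alpha> lnN' by (intro divide_left_mono) auto
      ultimately have "\<alpha> / sqrt (1 + ln (real N)) * level_weight N (edge_level e) \<le> \<alpha> * 1"
        using \<alpha> level_weight_nonneg by (intro mult_mono) auto
      with True show ?thesis
        by (simp add: \<beta>_def)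
    qed (use \<alpha> in \<open>simp add: \<beta>_def\<close>)
  qed
  have j\<beta>: "real j * \<beta> e \<le> 1 / 4" "0 \<le> real j * \<beta> e" if "j \<le> K" for j e
  proof -
    have "real j * \<beta> e \<le> real K * \<alpha>"
      using that \<beta> by (intro mult_mono) auto
    then show "real j * \<beta> e \<le> 1 / 4"
      using \<alpha> by simp
  qed (use \<beta> in simp)
  have k_pos: "1 / 2 < k j e" if "j \<le> K" for j e
    using j\<beta>(1)[OF that, of e] by (simp add: k_def)
  have second: "(\<Prod>e\<in>F. (k j e)\<^sup>2 / (2 * k j e - 1)) \<le> 1 + \<eta>\<^sup>2" if j: "j \<le> K" for j
  proof -
    have "(\<Prod>e\<in>F. (k j e)\<^sup>2 / (2 * k j e - 1)) \<le> (\<Prod>e\<in>F. exp (2 * (real j * \<beta> e)\<^sup>2))"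
    proof (intro prod_mono conjI)
      fix e
      show "0 \<le> (k j e)\<^sup>2 / (2 * k j e - 1)"
        using k_pos[OF j, of e] by simp
      show "(k j e)\<^sup>2 / (2 * k j e - 1) \<le> exp (2 * (real j * \<beta> e)\<^sup>2)"
        unfolding k_def by (rule second_moment_factor_le[OF j\<beta>(2,1)[OF j]])
    qed
    also have "\<dots> = exp (\<Sum>e\<in>F. 2 * (real j * \<beta> e)\<^sup>2)"
      using F by (simp add: exp_sum)
    also have "(\<Sum>e\<in>F. 2 * (real j * \<beta> e)\<^sup>2)
        = 2 * (real j * \<alpha>)\<^sup>2 / (1 + ln (real N)) * (\<Sum>e\<in>F. (level_weight N (edge_level e))\<^sup>2)"
      unfolding sum_distrib_left using lnN
      by (intro sum.cong refl) (simp add: \<beta>_def power_mult_distrib power_divide)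
    also have "\<dots> \<le> 2 * (real j * \<alpha>)\<^sup>2 / (1 + ln (real N)) * (24 * (1 + ln (real N)))"
      unfolding F_def using lnN by (intro mult_left_mono sum_level_weight_sq_le) auto
    also have "\<dots> = 48 * (real j * \<alpha>)\<^sup>2"
    proof -
      have "z / u * (24 * u) = 24 * z" if "0 < u" for z u :: real
        using that by simp
      from this[OF lnN'(2)] show ?thesis
        by simp
    qed
    also have "\<dots> \<le> 48 * (real K * \<alpha>)\<^sup>2"
      using j \<alpha> by (intro mult_left_mono power_mono mult_right_mono) auto
    also have "\<dots> \<le> ln (1 + \<eta>\<^sup>2)"
      by (rule \<eta>(2))
    also have "exp (ln (1 + \<eta>\<^sup>2)) = 1 + \<eta>\<^sup>2"
      by (intro exp_ln add_pos_nonneg) auto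
    finally show ?thesis
      by simp
  qed
  have A_meas [measurable]: "A j \<in> events" for j
    unfolding A_def T_def by measurable
  have G_meas [measurable]: "G \<in> events"
    by (simp add: G_def fast_walk_from_events)
  define p where "p = prob {\<omega>\<in>space M. first_passage_time (\<lambda>e. t e \<omega>) (0, 0) y \<in> {a..b}}"
  have p_le: "p \<le> prob (A j) + \<eta>" if j: "j \<le> K" for j
  proof -
    \<comment> \<open>First-passage times depend only on the configuration, so the comparison of laws applies.\<close>
    let ?S = "{s \<in> space configurations. first_passage_time s (0, 0) y \<in> {a..b}}"
    have S: "?S \<in> sets configurations"
      using first_passage_time_measurable[measurable] by measurable
    have conf: "(\<lambda>e\<in>lattice_edges. s e) \<in> space configurations" for s
      by (simp add: space_PiM)
    have "k j e = 1" if "e \<notin> F" for e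
      using that by (simp add: k_def \<beta>_def)
    from prob_le_prob_scaled[OF F k_pos[OF j] this \<eta>(1) second[OF j] S]
    show ?thesis
      by (simp add: p_def A_def T_def conf first_passage_time_restrict)
  qed
  have gap: "T i \<omega> + (b - a) < T j \<omega>" if ij: "i < j" "j \<le> K" and \<omega>: "\<omega> \<in> space M" "\<omega> \<notin> G" for i j \<omega>
  proof -
    let ?c = "\<alpha> / sqrt (1 + ln (real N)) * (min_speed * (ln (real N) - ln (real r0 + 1)))"
    have "T i \<omega> + ?c \<le> T j \<omega>"
      unfolding T_def
    proof (rule first_passage_time_add_le[where d = "\<lambda>e. \<beta> e * t e \<omega>"])
      fix e assume e: "e \<in> lattice_edges"
      then have t: "0 \<le> t e \<omega>"
        using nonneg \<omega> by simp
      have "i \<le> K"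
        using ij by simp
      from k_pos[OF this, of e] t show "0 \<le> t e \<omega> / k i e"
        by simp
      have "t e \<omega> * (1 / k i e + \<beta> e) \<le> t e \<omega> * (1 / k j e)"
        unfolding k_def using t ij by (intro mult_left_mono inverse_one_minus_gap \<beta> j\<beta>(1)) auto
      then show "t e \<omega> / k i e + \<beta> e * t e \<omega> \<le> t e \<omega> / k j e"
        by (simp add: algebra_simps)
    next
      fix q assume q: "lattice_path (0, 0) y q"
      have "?c \<le> \<alpha> / sqrt (1 + ln (real N)) * path_time (\<lambda>e. level_weight N (edge_level e) * t e \<omega>) q"
        using weighted_path_time_ge_ln[of \<omega> r0 y q] \<omega> r0 y q \<alpha> lnN
        by (intro mult_left_mono) (auto simp: G_def N_def)
      also have "\<dots> = path_time (\<lambda>e. \<alpha> / sqrt (1 + ln (real N)) * level_weight N (edge_level e) * t e \<omega>) q"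
        by (simp add: path_time_def sum_distrib_left mult.assoc)
      also have "\<dots> = path_time (\<lambda>e. \<beta> e * t e \<omega>) q"
        using q by (intro path_time_cong)
          (auto simp: lattice_path_def \<beta>_def F_def edges_within_def level_weight_eq_0)
      finally show "?c \<le> path_time (\<lambda>e. \<beta> e * t e \<omega>) q" .
    qed
    then show ?thesis
      using ab by (simp add: N_def)
  qed
  have "disjoint_family_on (\<lambda>j. A j - G) {..<K}"
    unfolding disjoint_family_on_def
  proof (intro ballI impI equals0I)
    fix i j \<omega> assume ij: "i \<in> {..<K}" "j \<in> {..<K}" "i \<noteq> j" and "\<omega> \<in> (A i - G) \<inter> (A j - G)"
    then have \<omega>: "\<omega> \<in> space M" "\<omega> \<notin> G" "a \<le> T i \<omega>" "T i \<omega> \<le> b" "a \<le> T j \<omega>" "T j \<omega> \<le> b"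
      by (auto simp: A_def)
    show False
      using gap[of i j \<omega>] gap[of j i \<omega>] ij \<omega> by (cases i j rule: linorder_cases) auto
  qed
  then have "(\<Sum>j<K. prob (A j - G)) = prob (\<Union>j<K. A j - G)"
    by (intro finite_measure_finite_Union[symmetric]) auto
  then have disj: "(\<Sum>j<K. prob (A j - G)) \<le> 1"
    by simp
  have "real K * p = (\<Sum>j<K. p)"
    by simp
  also have "\<dots> \<le> (\<Sum>j<K. prob (A j - G) + (prob G + \<eta>))"
  proof (intro sum_mono)
    fix j assume "j \<in> {..<K}"
    then have "p \<le> prob (A j) + \<eta>"
      by (intro p_le) simp
    also have "prob (A j) \<le> prob ((A j - G) \<union> G)"
      by (intro finite_measure_mono) auto
    also have "\<dots> \<le> prob (A j - G) + prob G"
      by (intro measure_Un_le) auto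
    finally show "p \<le> prob (A j - G) + (prob G + \<eta>)"
      by simp
  qed
  also have "\<dots> \<le> 1 + real K * (prob G + \<eta>)"
    using disj by (simp add: sum.distrib)
  finally have "real K * p \<le> real K * (1 / real K + prob G + \<eta>)"
    using K by (simp add: algebra_simps)
  then show ?thesis
    using K by (simp add: p_def G_def)
qed

text \<open>The three error terms are made at most \<open>\<epsilon> / 3\<close> one after the other, by the choice of
\<open>K\<close>, \<open>r0\<close> and \<open>\<eta>\<close>; then \<open>\<alpha>\<close> is taken so small that \<open>K\<close>
perturbations still cost at most \<open>\<eta>\<close>.  None of these choices depends on the endpoint, and the
separation is of order \<open>\<alpha> \<surd>ln N\<close> once \<open>ln N\<close> dominates \<open>ln (r0 + 1)\<close>.\<close>

lemma small_intervals_unlikely: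
  assumes "0 < \<epsilon>"
  obtains \<delta> N0 where "0 < \<delta>" "2 \<le> N0"
    "\<And>y a b. N0 \<le> level y \<Longrightarrow> b - a \<le> \<delta> * sqrt (ln (real (level y))) \<Longrightarrow>
      prob {\<omega>\<in>space M. first_passage_time (\<lambda>e. t e \<omega>) (0, 0) y \<in> {a..b}} \<le> \<epsilon>"
proof -
  define \<eta> where "\<eta> = \<epsilon> / 3"
  have \<eta>: "0 < \<eta>"
    using assms by (simp add: \<eta>_def)
  obtain K :: nat where K: "1 / \<eta> \<le> real K" "1 \<le> K"
    using real_arch_simple[of "max 1 (1 / \<eta>)"] by auto
  have K': "1 / real K \<le> \<eta>"
    using K \<eta> by (simp add: field_simps)
  obtain m where m: "(1 / 2) ^ m < \<eta> / 2"
    using real_arch_pow_inv[of "\<eta> / 2" "1 / 2"] \<eta> by auto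
  define r0 where "r0 = Suc m"
  have r0: "1 \<le> r0" "prob (fast_walk_from r0) \<le> \<eta>"
    using prob_fast_walk_from_le[of r0] m \<eta> by (auto simp: r0_def)
  have ln\<eta>: "0 < ln (1 + \<eta>\<^sup>2)"
    using \<eta> by (intro ln_gt_zero) simp
  define \<alpha> where "\<alpha> = min (1 / 4) (sqrt (ln (1 + \<eta>\<^sup>2) / 48)) / real K"
  have \<alpha>: "0 < \<alpha>" "real K * \<alpha> = min (1 / 4) (sqrt (ln (1 + \<eta>\<^sup>2) / 48))"
    using K ln\<eta> by (auto simp: \<alpha>_def)
  have "(real K * \<alpha>)\<^sup>2 \<le> (sqrt (ln (1 + \<eta>\<^sup>2) / 48))\<^sup>2"
    unfolding \<alpha>(2) using ln\<eta> by (intro power_mono) auto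
  then have \<alpha>2: "48 * (real K * \<alpha>)\<^sup>2 \<le> ln (1 + \<eta>\<^sup>2)"
    using ln\<eta> by simp
  \<comment> \<open>The bounds \<open>sqrt (1 + l) \<le> 2 * sqrt l\<close> and \<open>l - ln (r0 + 1) \<ge> l / 2\<close> lose a factor 4; the
    other factor 2 makes the inequality strict.\<close>
  define \<delta> where "\<delta> = \<alpha> * min_speed / 8"
  \<comment> \<open>For \<open>N \<ge> N0\<close> and \<open>l = ln N\<close>, this ensures \<open>l \<ge> 1\<close> and \<open>ln (r0 + 1) \<le> l / 2\<close>.\<close>
  define N0 where "N0 = max 3 ((r0 + 1)\<^sup>2)"
  show thesis
  proof (rule that)
    show "0 < \<delta>" "2 \<le> N0"
      using \<alpha> min_speed_pos by (auto simp: \<delta>_def N0_def)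
    fix y a b assume y: "N0 \<le> level y" and ab: "b - a \<le> \<delta> * sqrt (ln (real (level y)))"
    define l where "l = ln (real (level y))"
    have "1 = ln (exp (1 :: real))"
      by simp
    also have "\<dots> \<le> l"
      unfolding l_def using y exp_le by (subst ln_le_cancel_iff) (auto simp: N0_def)
    finally have l1: "1 \<le> l" .
    have "2 * ln (real r0 + 1) = ln ((real r0 + 1)\<^sup>2)"
      by (simp add: ln_realpow)
    also have "\<dots> = ln (real ((r0 + 1)\<^sup>2))"
      by (simp add: add.commute)
    also have "\<dots> \<le> l"
      unfolding l_def using y by (subst ln_le_cancel_iff) (auto simp: N0_def simp del: of_nat_power)
    finally have l2: "ln (real r0 + 1) \<le> l / 2"
      by simp
    have "sqrt (1 + l) \<le> sqrt (4 * l)"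
      using l1 by (intro real_sqrt_le_mono) simp
    then have s: "sqrt (1 + l) \<le> 2 * sqrt l" "0 < sqrt (1 + l)" "0 < sqrt l"
      using l1 by (auto simp: real_sqrt_mult)
    have "b - a \<le> \<delta> * sqrt l"
      using ab by (simp add: l_def)
    also have "\<dots> < \<alpha> * min_speed * (sqrt l / 4)"
      using \<alpha> min_speed_pos s by (simp add: \<delta>_def)
    also have "\<dots> = \<alpha> * min_speed * ((l / 2) / (2 * sqrt l))"
      using s l1 real_sqrt_mult_self[of l] by (simp add: field_simps)
    also have "\<dots> \<le> \<alpha> * min_speed * ((l - ln (real r0 + 1)) / sqrt (1 + l))"
      using \<alpha> min_speed_pos l1 l2 s by (intro mult_left_mono frac_le) auto
    finally have "b - a < \<alpha> / sqrt (1 + l) * (min_speed * (l - ln (real r0 + 1)))"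
      by (simp add: mult_ac)
    then have "prob {\<omega>\<in>space M. first_passage_time (\<lambda>e. t e \<omega>) (0, 0) y \<in> {a..b}}
        \<le> 1 / real K + prob (fast_walk_from r0) + \<eta>"
      using \<alpha> \<alpha>2 \<eta> K r0 y
      by (intro prob_first_passage_interval_le[of \<alpha>]) (auto simp: l_def N0_def)
    also have "\<dots> \<le> \<epsilon>"
      using K' r0 by (simp add: \<eta>_def)
    finally show "prob {\<omega>\<in>space M. first_passage_time (\<lambda>e. t e \<omega>) (0, 0) y \<in> {a..b}} \<le> \<epsilon>" .
  qed
qed

section \<open>Variance\<close>

text \<open>Without square integrability the variance would be the integral of a non-integrable function,
which is \<open>0\<close> by convention, and Chebyshev's inequality would fail.\<close>

lemma integrable_first_passage_sq:
  "integrable M (\<lambda>\<omega>. (first_passage_time (\<lambda>e. t e \<omega>) (0, 0) y)\<^sup>2)"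
proof -
  obtain p where p: "lattice_path (0, 0) y p"
    using ex_lattice_path by blast
  then have succ: "successively adjacent p"
    by (simp add: lattice_path_def)
  let ?n = "length p - 1"
  let ?g = "\<lambda>\<omega>. real ?n * (\<Sum>i<?n. (t {p ! i, p ! Suc i} \<omega>)\<^sup>2)"
  have "integrable M ?g"
  proof (intro integrable_mult_right Bochner_Integration.integrable_sum)
    fix i assume "i \<in> {..<?n}"
    then have "{p ! i, p ! Suc i} \<in> lattice_edges"
      by (intro path_edge_in_lattice[OF succ]) auto
    from erlang_ith_moment_integrable[OF _ exponential[OF this], of 2]
    show "integrable M (\<lambda>\<omega>. (t {p ! i, p ! Suc i} \<omega>)\<^sup>2)"
      by simp
  qed
  then show ?thesis
  proof (rule Bochner_Integration.integrable_bound)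
    show "AE \<omega> in M. norm ((first_passage_time (\<lambda>e. t e \<omega>) (0, 0) y)\<^sup>2) \<le> norm (?g \<omega>)"
    proof (intro AE_I2)
      fix \<omega> assume \<omega>: "\<omega> \<in> space M"
      let ?T = "first_passage_time (\<lambda>e. t e \<omega>) (0, 0) y"
      have "0 \<le> ?T"
        using path_time_nonneg nonneg \<omega> by (intro first_passage_time_ge) (auto simp: lattice_path_def)
      moreover have "?T \<le> path_time (\<lambda>e. t e \<omega>) p"
        using nonneg \<omega> p by (intro path_time_le_first_passage) auto
      ultimately have "?T\<^sup>2 \<le> (path_time (\<lambda>e. t e \<omega>) p)\<^sup>2"
        by (intro power_mono)
      also have "\<dots> \<le> ?g \<omega>"
        unfolding path_time_def using sum_squared_le_sum_of_squares[of "\<lambda>i. t {p ! i, p ! Suc i} \<omega>" "{..<?n}"]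
        by (simp add: mult.commute)
      finally show "norm (?T\<^sup>2) \<le> norm (?g \<omega>)"
        by simp
    qed
  qed measurable
qed

lemma variance_first_passage_ge:
  assumes "0 < c"
  shows "prob {\<omega>\<in>space M. \<bar>first_passage_time (\<lambda>e. t e \<omega>) (0, 0) y
      - expectation (\<lambda>\<omega>. first_passage_time (\<lambda>e. t e \<omega>) (0, 0) y)\<bar> \<ge> c} * c\<^sup>2
    \<le> variance (\<lambda>\<omega>. first_passage_time (\<lambda>e. t e \<omega>) (0, 0) y)"
  using Chebyshev_inequality[OF first_passage_measurable integrable_first_passage_sq assms, of y] assms
  by (subst pos_le_divide_eq[symmetric]) auto

text \<open>With positive probability all edges at the origin, and hence every path leaving it, cost more than
\<open>c\<close>, which exceeds the mean by at least one.\<close>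

lemma variance_first_passage_pos:
  assumes y: "1 \<le> level y"
  shows "0 < variance (\<lambda>\<omega>. first_passage_time (\<lambda>e. t e \<omega>) (0, 0) y)"
proof -
  let ?T = "\<lambda>\<omega>. first_passage_time (\<lambda>e. t e \<omega>) (0, 0) y"
  \<comment> \<open>The absolute value keeps \<open>c\<close> nonnegative, as the exponential tail formula requires.\<close>
  define c where "c = \<bar>expectation ?T\<bar> + 1"
  define F where "F = (\<lambda>z. {(0, 0), z}) ` neighbours (0, 0)"
  have F: "finite F" "F \<subseteq> lattice_edges" "F \<noteq> {}"
    using finite_neighbours edge_in_lattice[of "(0, 0)"]
    by (auto simp: F_def adjacent_iff_neighbours neighbours_def)
  define A where "A = (\<Inter>e\<in>F. t e -` {c<..} \<inter> space M)"
  have "prob A = (\<Prod>e\<in>F. prob (t e -` {c<..} \<inter> space M))"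
    unfolding A_def using F by (intro indep_varsD[OF indep]) auto
  also have "\<dots> = (\<Prod>e\<in>F. exp (- c))"
  proof (intro prod.cong refl)
    fix e assume "e \<in> F"
    then have "prob {\<omega>\<in>space M. c < t e \<omega>} = exp (- c * 1)"
      using F by (intro exponential_distributedD_gt[OF exponential]) (auto simp: c_def)
    then show "prob (t e -` {c<..} \<inter> space M) = exp (- c)"
      by (simp add: vimage_def Int_def conj_commute)
  qed
  also have "\<dots> > 0"
    by (intro prod_pos) simp
  finally have pos: "0 < prob A" .
  have "A \<subseteq> {\<omega>\<in>space M. \<bar>?T \<omega> - expectation ?T\<bar> \<ge> 1}"
  proof
    fix \<omega> assume "\<omega> \<in> A"
    then have \<omega>: "\<omega> \<in> space M" "\<And>e. e \<in> F \<Longrightarrow> c < t e \<omega>"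
      using F(3) by (auto simp: A_def)
    have "c \<le> ?T \<omega>"
    proof (rule first_passage_time_ge)
      fix p assume p: "lattice_path (0, 0) y p"
      moreover have "y \<noteq> (0, 0)"
        using y by auto
      ultimately obtain z q where q: "p = (0, 0) # z # q" "adjacent (0, 0) z" "successively adjacent (z # q)"
        by (cases p rule: list.exhaust; cases "tl p") (auto simp: lattice_path_def)
      then have "c < t {(0, 0), z} \<omega>" "0 \<le> path_time (\<lambda>e. t e \<omega>) (z # q)"
        using \<omega> nonneg by (auto simp: F_def adjacent_iff_neighbours intro!: path_time_nonneg)
      then show "c \<le> path_time (\<lambda>e. t e \<omega>) p"
        by (simp add: q(1))
    qed
    then show "\<omega> \<in> {\<omega>\<in>space M. \<bar>?T \<omega> - expectation ?T\<bar> \<ge> 1}"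
      using \<omega> by (auto simp: c_def)
  qed
  then have "prob A \<le> prob {\<omega>\<in>space M. \<bar>?T \<omega> - expectation ?T\<bar> \<ge> 1}"
    by (intro finite_measure_mono) measurable
  with pos variance_first_passage_ge[of 1 y] show ?thesis
    by simp
qed

text \<open>The interval of half-length \<open>(\<delta> / 2) \<surd>ln N\<close> around the mean has probability at most
\<open>1 / 2\<close>.\<close>

lemma variance_first_passage_ge_ln:
  obtains C N0 where "0 < C" "\<And>y. N0 \<le> level y \<Longrightarrow>
    C * ln (real (level y)) \<le> variance (\<lambda>\<omega>. first_passage_time (\<lambda>e. t e \<omega>) (0, 0) y)"
proof -
  obtain \<delta> N0 where \<delta>: "0 < \<delta>" "2 \<le> N0"
    "\<And>y a b. N0 \<le> level y \<Longrightarrow> b - a \<le> \<delta> * sqrt (ln (real (level y))) \<Longrightarrow>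
      prob {\<omega>\<in>space M. first_passage_time (\<lambda>e. t e \<omega>) (0, 0) y \<in> {a..b}} \<le> 1 / 2"
    using small_intervals_unlikely[of "1 / 2"] by auto
  show thesis
  proof (rule that)
    show "0 < \<delta>\<^sup>2 / 8"
      using \<delta> by simp
    fix y assume y: "N0 \<le> level y"
    let ?T = "\<lambda>\<omega>. first_passage_time (\<lambda>e. t e \<omega>) (0, 0) y"
    define m where "m = expectation ?T"
    define l where "l = ln (real (level y))"
    define c where "c = \<delta> / 2 * sqrt l"
    have l: "0 < l"
      unfolding l_def using y \<delta>(2) by (intro ln_gt_zero) auto
    then have c: "0 < c"
      using \<delta> by (simp add: c_def)
    have "prob {\<omega>\<in>space M. ?T \<omega> \<in> {m - c..m + c}} \<le> 1 / 2"
      by (rule \<delta>(3)[OF y]) (simp add: c_def l_def)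
    moreover have "1 \<le> prob ({\<omega>\<in>space M. ?T \<omega> \<in> {m - c..m + c}} \<union> {\<omega>\<in>space M. \<bar>?T \<omega> - m\<bar> \<ge> c})"
    proof -
      have "{\<omega>\<in>space M. ?T \<omega> \<in> {m - c..m + c}} \<union> {\<omega>\<in>space M. \<bar>?T \<omega> - m\<bar> \<ge> c} = space M"
        by auto
      then show ?thesis
        by (simp add: prob_space)
    qed
    moreover have "prob ({\<omega>\<in>space M. ?T \<omega> \<in> {m - c..m + c}} \<union> {\<omega>\<in>space M. \<bar>?T \<omega> - m\<bar> \<ge> c})
        \<le> prob {\<omega>\<in>space M. ?T \<omega> \<in> {m - c..m + c}} + prob {\<omega>\<in>space M. \<bar>?T \<omega> - m\<bar> \<ge> c}"
      by (intro measure_Un_le) measurable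
    ultimately have "1 / 2 \<le> prob {\<omega>\<in>space M. \<bar>?T \<omega> - m\<bar> \<ge> c}"
      by linarith
    then have "1 / 2 * c\<^sup>2 \<le> prob {\<omega>\<in>space M. \<bar>?T \<omega> - m\<bar> \<ge> c} * c\<^sup>2"
      by (rule mult_right_mono) simp
    also have "\<dots> \<le> variance ?T"
      unfolding m_def by (rule variance_first_passage_ge[OF c])
    also have "1 / 2 * c\<^sup>2 = \<delta>\<^sup>2 / 8 * l"
      using l by (simp add: c_def power_mult_distrib power_divide)
    finally show "\<delta>\<^sup>2 / 8 * ln (real (level y)) \<le> variance ?T"
      by (simp add: l_def)
  qed
qed

end

section \<open>Endpoints in a fixed direction\<close>

lemma level_lattice_point_ge:
  assumes "norm v = 1"
  shows "real n - 2 \<le> real (level (lattice_point v n))"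
proof -
  obtain x z where v: "v = (x, z)"
    by (cases v)
  have "1 \<le> \<bar>x\<bar> + \<bar>z\<bar>"
    using assms sqrt_sum_squares_le_sum_abs[of x z] by (simp add: v norm_Pair)
  then have "real n * 1 \<le> real n * (\<bar>x\<bar> + \<bar>z\<bar>)"
    by (intro mult_left_mono) auto
  then have "real n \<le> \<bar>real n * x\<bar> + \<bar>real n * z\<bar>"
    by (simp add: abs_mult algebra_simps)
  moreover have "\<bar>r\<bar> - 1 \<le> \<bar>real_of_int \<lfloor>r\<rfloor>\<bar>" for r :: real
    by linarith
  note this[of "real n * x"] this[of "real n * z"]
  ultimately have "real n - 2 \<le> \<bar>real_of_int \<lfloor>real n * x\<rfloor>\<bar> + \<bar>real_of_int \<lfloor>real n * z\<rfloor>\<bar>"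
    by linarith
  then show ?thesis
    by (simp add: level_def lattice_point_def v)
qed

text \<open>If both integer parts vanish then \<open>n v\<close> lies in the unit square, whose diameter is
\<open>\<surd>2 < 2\<close>.\<close>

lemma level_lattice_point_pos:
  assumes "norm v = 1" "2 \<le> n"
  shows "1 \<le> level (lattice_point v n)"
proof (rule ccontr)
  obtain x z where v: "v = (x, z)"
    by (cases v)
  assume "\<not> ?thesis"
  then have "\<lfloor>real n * x\<rfloor> = 0" "\<lfloor>real n * z\<rfloor> = 0"
    by (auto simp: level_def lattice_point_def v)
  then have "0 \<le> real n * x" "real n * x \<le> 1" "0 \<le> real n * z" "real n * z \<le> 1"
    by linarith+
  then have "(real n * x)\<^sup>2 \<le> 1" "(real n * z)\<^sup>2 \<le> 1"
    by (auto intro: power_le_one)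
  then have "(real n)\<^sup>2 * (x\<^sup>2 + z\<^sup>2) \<le> 2"
    by (simp add: power_mult_distrib algebra_simps)
  moreover have "x\<^sup>2 + z\<^sup>2 = 1"
    using assms(1) by (simp add: v norm_Pair)
  moreover have "2\<^sup>2 \<le> (real n)\<^sup>2"
    using assms(2) by (intro power_mono) auto
  ultimately show False
    by simp
qed

text \<open>For \<open>n \<ge> 4\<close> one has \<open>n - 2 \<ge> \<surd>n\<close>.\<close>

lemma ln_level_lattice_point_ge:
  assumes "norm v = 1" "4 \<le> n"
  shows "ln (real n) / 2 \<le> ln (real (level (lattice_point v n)))"
proof -
  have "real n \<le> (real n - 2)\<^sup>2"
  proof -
    have "0 \<le> (real n - 1) * (real n - 4)"
      using assms by simp
    then show ?thesis
      by (simp add: power2_eq_square algebra_simps)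
  qed
  also have "\<dots> \<le> (real (level (lattice_point v n)))\<^sup>2"
    using level_lattice_point_ge[OF assms(1), of n] assms(2) by (intro power_mono) auto
  finally have "ln (real n) \<le> ln ((real (level (lattice_point v n)))\<^sup>2)"
    using assms(2) level_lattice_point_pos[OF assms(1), of n] by (subst ln_le_cancel_iff) auto
  then show ?thesis
    using level_lattice_point_pos[OF assms(1), of n] assms(2) by (simp add: ln_realpow)
qed

theorem theorem1:
  fixes M :: "'a measure"
    and t :: "vertex set \<Rightarrow> 'a \<Rightarrow> real"
    and v :: "real \<times> real"
    and T :: "nat \<Rightarrow> 'a \<Rightarrow> real"
  defines "T \<equiv> \<lambda>n \<omega>. first_passage_time (\<lambda>e. t e \<omega>) (0, 0) (lattice_point v n)"
  assumes "prob_space M"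
    and nonneg: "\<And>e \<omega>. e \<in> lattice_edges \<Longrightarrow> \<omega> \<in> space M \<Longrightarrow> 0 \<le> t e \<omega>"
    and indep: "prob_space.indep_vars M (\<lambda>_. borel) t lattice_edges"
    and exponential: "\<And>e. e \<in> lattice_edges \<Longrightarrow> distributed M lborel (t e) (exponential_density 1)"
    and unit: "norm v = 1"
  shows "(\<exists>C>0. \<forall>n\<ge>1. prob_space.variance M (T n) \<ge> C * ln (real n)) \<and>
    (\<forall>a b :: nat \<Rightarrow> real.
       (\<forall>n\<ge>1. a n \<le> b n) \<longrightarrow>
       (\<lambda>n. b n - a n) \<in> o(\<lambda>n. sqrt (ln (real n))) \<longrightarrow>
       (\<lambda>n. measure M {\<omega> \<in> space M. T n \<omega> \<in> {a n..b n}}) \<longlonglongrightarrow> 0)"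
proof -
  interpret prob_space M
    by fact
  interpret exponential_edge_times M t
    by unfold_locales (use nonneg indep exponential in auto)
  let ?y = "lattice_point v"
  show ?thesis
  proof (intro conjI allI impI)
    obtain C N0 where C: "0 < C"
      "\<And>y. N0 \<le> level y \<Longrightarrow>
        C * ln (real (level y)) \<le> variance (\<lambda>\<omega>. first_passage_time (\<lambda>e. t e \<omega>) (0, 0) y)"
      by (rule variance_first_passage_ge_ln) blast
    \<comment> \<open>The level of the endpoint is at least \<open>n - 2\<close>, and \<open>ln_level_lattice_point_ge\<close> needs \<open>n \<ge> 4\<close>.\<close>
    define n0 where "n0 = N0 + 4"
    \<comment> \<open>The factor \<open>1 / 2\<close> absorbs the passage from \<open>ln n\<close> to the logarithm of the level of the endpoint.\<close>
    define D where "D = Min (insert (C / 2) ((\<lambda>n. variance (T n) / ln (real n)) ` {2..<n0}))"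
    have ln_pos: "0 < ln (real n)" if "2 \<le> n" for n :: nat
      using that by (intro ln_gt_zero) auto
    have "0 < variance (T n)" if "2 \<le> n" for n
      unfolding T_def using level_lattice_point_pos[OF unit that] by (rule variance_first_passage_pos)
    then have "0 < D"
      unfolding D_def using C ln_pos by (subst Min_gr_iff) auto
    moreover have "D * ln (real n) \<le> variance (T n)" if n: "1 \<le> n" for n
    proof -
      consider "n = 1" | "2 \<le> n" "n < n0" | "n0 \<le> n"
        using n by linarith
      then show ?thesis
      proof cases
        case 1
        then show ?thesis
          by simp
      next
        case 2
        then have "D \<le> variance (T n) / ln (real n)"
          unfolding D_def by (intro Min_le) auto
        then show ?thesis
          using ln_pos[OF 2(1)] by (simp add: field_simps)
      next
        case 3
        have lev: "N0 \<le> level (?y n)"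
          using level_lattice_point_ge[OF unit, of n] 3 by (simp add: n0_def)
        have "D * ln (real n) \<le> C / 2 * ln (real n)"
          unfolding D_def using ln_pos[of n] 3 by (intro mult_right_mono Min_le) (auto simp: n0_def)
        also have "\<dots> \<le> C * ln (real (level (?y n)))"
          using ln_level_lattice_point_ge[OF unit, of n] C(1) 3 by (simp add: n0_def)
        also have "\<dots> \<le> variance (T n)"
          unfolding T_def by (rule C(2)[OF lev])
        finally show ?thesis .
      qed
    qed
    ultimately show "\<exists>C>0. \<forall>n\<ge>1. variance (T n) \<ge> C * ln (real n)"
      by blast
  next
    fix a b :: "nat \<Rightarrow> real"
    assume small: "(\<lambda>n. b n - a n) \<in> o(\<lambda>n. sqrt (ln (real n)))"
    show "(\<lambda>n. measure M {\<omega> \<in> space M. T n \<omega> \<in> {a n..b n}}) \<longlonglongrightarrow> 0"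
    proof (rule LIMSEQ_I)
      fix \<epsilon> :: real assume "0 < \<epsilon>"
      then obtain \<delta> N0 where \<delta>: "0 < \<delta>"
        "\<And>y a b. N0 \<le> level y \<Longrightarrow> b - a \<le> \<delta> * sqrt (ln (real (level y))) \<Longrightarrow>
          prob {\<omega>\<in>space M. first_passage_time (\<lambda>e. t e \<omega>) (0, 0) y \<in> {a..b}} \<le> \<epsilon> / 2"
        by (rule small_intervals_unlikely[OF half_gt_zero]) blast
      have "\<forall>\<^sub>F n in sequentially. norm (b n - a n) \<le> \<delta> / 2 * norm (sqrt (ln (real n)))"
        using landau_o.smallD[OF small, of "\<delta> / 2"] \<delta>(1) by simp
      then obtain n1 where n1: "\<And>n. n1 \<le> n \<Longrightarrow> norm (b n - a n) \<le> \<delta> / 2 * norm (sqrt (ln (real n)))"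
        unfolding eventually_sequentially by blast
      show "\<exists>n0. \<forall>n\<ge>n0. norm (measure M {\<omega> \<in> space M. T n \<omega> \<in> {a n..b n}} - 0) < \<epsilon>"
      proof (intro exI allI impI)
        fix n assume n: "max n1 (N0 + 4) \<le> n"
        let ?l = "ln (real (level (?y n)))"
        have l: "ln (real n) / 2 \<le> ?l" "0 \<le> ln (real n)"
          using ln_level_lattice_point_ge[OF unit, of n] n by auto
        have "sqrt (ln (real n)) \<le> sqrt (4 * ?l)"
          using l by (intro real_sqrt_le_mono) linarith
        then have "sqrt (ln (real n)) \<le> 2 * sqrt ?l"
          by (simp add: real_sqrt_mult)
        then have "\<delta> / 2 * sqrt (ln (real n)) \<le> \<delta> / 2 * (2 * sqrt ?l)"
          using \<delta>(1) by (intro mult_left_mono) auto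
        moreover have "\<bar>b n - a n\<bar> \<le> \<delta> / 2 * sqrt (ln (real n))"
          using n1[of n] n l(2) by simp
        ultimately have "b n - a n \<le> \<delta> * sqrt ?l"
          by linarith
        moreover have "N0 \<le> level (?y n)"
          using level_lattice_point_ge[OF unit, of n] n by simp
        ultimately have "prob {\<omega>\<in>space M. T n \<omega> \<in> {a n..b n}} \<le> \<epsilon> / 2"
          unfolding T_def by (intro \<delta>(2))
        then show "norm (measure M {\<omega> \<in> space M. T n \<omega> \<in> {a n..b n}} - 0) < \<epsilon>"
          using \<open>0 < \<epsilon>\<close> by simp
      qed
    qed
  qed
qed

end
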